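(* Let $\alpha>\frac12$, $\gamma\ge0$ with $\alpha>\gamma$, and let $0<c_1\le c_2$. For all $R\ge0$ and every reconstructing rank-1 lattice $\Lambda(\boldsymbol z,M)$ for $G_R^2$ with $c_1 2^{2R}\le M\le c_2 2^{2R}$, $$\big\|\mathrm{Id}-S^{\Lambda(\boldsymbol z,M)}_{G_R^2}\big|\mathcal{H}^{\alpha}_{\mathrm{mix}}(\mathbb{T}^2)\to\mathcal{H}^{\gamma}(\mathbb{T}^2)\big\|\asymp M^{-(\alpha-\gamma)/2},$$ with constants depending only on $\alpha,\gamma,c_1,c_2$.
   Context: $\mathbb{T}=[0,1)$ is the torus, $\hat f_{\boldsymbol k}=\int_{\mathbb{T}^2}f(\boldsymbol x)e^{-2\pi i\boldsymbol k\cdot\boldsymbol x}\,d\boldsymbol x$. $\mathcal{H}^{\alpha}_{\mathrm{mix}}(\mathbb{T}^2)$ and $\mathcal{H}^{\gamma}(\mathbb{T}^2)$ are the spaces of $f\in L_2(\mathbb{T}^2)$ with finite norms $$\|f|\mathcal{H}^{\alpha}_{\mathrm{mix}}(\mathbb{T}^2)\|^2=\sum_{\boldsymbol k\in\mathbb{Z}^2}|\hat f_{\boldsymbol k}|^2\prod_{s=1}^2(1+|k_s|^2)^{\alpha},\qquad \|f|\mathcal{H}^{\gamma}(\mathbb{T}^2)\|^2=\sum_{\boldsymbol k\in\mathbb{Z}^2}|\hat f_{\boldsymbol k}|^2(1+\|\boldsymbol k\|_2^2)^{\gamma}.$$ For $\alpha>\frac12$ elements of $\mathcal{H}^{\alpha}_{\mathrm{mix}}(\mathbb{T}^2)$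 are continuous (after choosing the continuous representative). $G_R^2:=(-2^{\lfloor R\rfloor-1},2^{\lfloor R\rfloor-1}]^2\cap\mathbb{Z}^2$. For $\boldsymbol z\in\mathbb{Z}^2$, $M\in\mathbb{N}$, the rank-1 lattice is $\Lambda(\boldsymbol z,M)=\{\frac jM\boldsymbol z\bmod\boldsymbol 1:j=0,\dots,M-1\}$. For finite $I\subset\mathbb{Z}^2$ the sampling operator is $$S_I^{\Lambda(\boldsymbol z,M)}f=\sum_{\boldsymbol k\in I}\hat f_{\boldsymbol k}^{\Lambda(\boldsymbol z,M)}e^{2\pi i\boldsymbol k\cdot\circ},\qquad \hat f_{\boldsymbol k}^{\Lambda(\boldsymbol z,M)}=\frac1M\sum_{j=0}^{M-1}f\big(\tfrac jM\boldsymbol z\big)e^{-2\pi i\frac jM\boldsymbol k\cdot\boldsymbol z}.$$ $\Lambda(\boldsymbol z,M)$ is a reconstructing rank-1 lattice for $I$ if $S_I^{\Lambda(\boldsymbol z,M)}p=p$ for all trigonometric polynomials $p$ with frequencies in $I$; equivalently $\boldsymbol k^1\cdot\boldsymbol z\not\equiv\boldsymbol k^2\cdot\boldsymbol z\pmod M$ for all distinct $\boldsymbol k^1,\boldsymbol k^2\in I$. $\|A|X\to Y\|$ is the operator norm; $a\asymp b$ means $c\,b\le a\le C\,b$ with constants $c,C>0$ depending only on the indicated parameters (not on $R,\boldsymbol z,M$). *)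

theory Defs
  imports "HOL-Analysis.Analysis"
begin

text \<open>
  Functions on the torus are 1-periodic functions on the plane. Elements of $L_2$ are equivalence
  classes; they are represented here by arbitrary (Borel) members, and all norms below depend only
  on the class.
\<close>

definition periodic2 :: "(real \<times> real \<Rightarrow> 'a) \<Rightarrow> bool" where
  "periodic2 f \<longleftrightarrow> (\<forall>x y. f (x + 1, y) = f (x, y) \<and> f (x, y + 1) = f (x, y))"

definition unit_square :: "(real \<times> real) set" where
  "unit_square = {0..<1} \<times> {0..<1}"

definition L2_torus :: "(real \<times> real \<Rightarrow> complex) set" where
  "L2_torus = {f \<in> borel_measurable borel. periodic2 f \<and>
     set_integrable lborel unit_square (\<lambda>x. (cmod (f x))\<^sup>2)}"

definition pairing :: "int \<times> int \<Rightarrow> real \<times> real \<Rightarrow> real" where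
  "pairing k x = of_int (fst k) * fst x + of_int (snd k) * snd x"

definition character :: "int \<times> int \<Rightarrow> real \<times> real \<Rightarrow> complex" where
  "character k x = exp (2 * of_real pi * \<i> * of_real (pairing k x))"

definition fourier_coeff :: "(real \<times> real \<Rightarrow> complex) \<Rightarrow> int \<times> int \<Rightarrow> complex" where
  "fourier_coeff f k =
     (LINT x:unit_square|lborel. f x * exp (- 2 * of_real pi * \<i> * of_real (pairing k x)))"

text \<open>
  Norms take the value \<open>\<infinity>\<close> outside the space they define, so the space is the set of functions of
  finite norm.
\<close>

definition weighted_norm ::
    "(int \<times> int \<Rightarrow> real) \<Rightarrow> (real \<times> real \<Rightarrow> complex) \<Rightarrow> ennreal" where
  "weighted_norm w f =
     (if f \<in> L2_torus \<and> (\<lambda>k. (cmod (fourier_coeff f k))\<^sup>2 * w k) summable_on UNIV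
      then ennreal (sqrt (\<Sum>\<^sub>\<infinity>k. (cmod (fourier_coeff f k))\<^sup>2 * w k))
      else \<infinity>)"

definition Hmix_norm :: "real \<Rightarrow> (real \<times> real \<Rightarrow> complex) \<Rightarrow> ennreal" where
  "Hmix_norm \<alpha> = weighted_norm (\<lambda>(k1, k2).
     (1 + \<bar>of_int k1\<bar>\<^sup>2) powr \<alpha> * (1 + \<bar>of_int k2\<bar>\<^sup>2) powr \<alpha>)"

definition H_norm :: "real \<Rightarrow> (real \<times> real \<Rightarrow> complex) \<Rightarrow> ennreal" where
  "H_norm \<gamma> = weighted_norm (\<lambda>(k1, k2).
     (1 + ((of_int k1)\<^sup>2 + (of_int k2)\<^sup>2)) powr \<gamma>)"

text \<open>
  The norm of \<open>T\<close> between the spaces given by the extended norms \<open>nX\<close>, \<open>nY\<close>. It is \<open>\<infinity>\<close> if \<open>T\<close>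
  maps some element of the unit ball outside the target space, or if \<open>T\<close> is unbounded.
\<close>

definition operator_norm :: "('f \<Rightarrow> ennreal) \<Rightarrow> ('g \<Rightarrow> ennreal) \<Rightarrow> ('f \<Rightarrow> 'g) \<Rightarrow> ennreal" where
  "operator_norm nX nY T = (SUP f\<in>{f. nX f \<le> 1}. nY (T f))"

text \<open>Point evaluation of a class in $L_2$ refers to this representative, which is unique if it exists.\<close>

definition continuous_rep :: "(real \<times> real \<Rightarrow> complex) \<Rightarrow> real \<times> real \<Rightarrow> complex" where
  "continuous_rep f =
     (THE g. continuous_on UNIV g \<and> periodic2 g \<and> (AE x in lborel. g x = f x))"

definition G :: "real \<Rightarrow> (int \<times> int) set" where
  "G R = {(k1, k2).
     of_int k1 \<in> {- ((2::real) powi (\<lfloor>R\<rfloor> - 1)) <.. 2 powi (\<lfloor>R\<rfloor> - 1)} \<and>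
     of_int k2 \<in> {- ((2::real) powi (\<lfloor>R\<rfloor> - 1)) <.. 2 powi (\<lfloor>R\<rfloor> - 1)}}"

text \<open>Sampling is along the rank-1 lattice generated by \<open>z\<close>; reduction modulo 1 is
  immaterial for periodic functions.\<close>

definition lattice_node :: "int \<times> int \<Rightarrow> nat \<Rightarrow> nat \<Rightarrow> real \<times> real" where
  "lattice_node z M j = (real j / real M * of_int (fst z), real j / real M * of_int (snd z))"

definition lattice_coeff ::
    "int \<times> int \<Rightarrow> nat \<Rightarrow> (real \<times> real \<Rightarrow> complex) \<Rightarrow> int \<times> int \<Rightarrow> complex" where
  "lattice_coeff z M f k = 1 / of_nat M * (\<Sum>j<M. f (lattice_node z M j) *
     exp (- 2 * of_real pi * \<i> * of_real (pairing k (lattice_node z M j))))"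

definition sampling_op ::
    "(int \<times> int) set \<Rightarrow> int \<times> int \<Rightarrow> nat \<Rightarrow>
     (real \<times> real \<Rightarrow> complex) \<Rightarrow> real \<times> real \<Rightarrow> complex" where
  "sampling_op I z M f = (\<lambda>x. \<Sum>k\<in>I. lattice_coeff z M f k * character k x)"

definition trig_polys :: "(int \<times> int) set \<Rightarrow> (real \<times> real \<Rightarrow> complex) set" where
  "trig_polys I = {p. \<exists>c. p = (\<lambda>x. \<Sum>k\<in>I. c k * character k x)}"

definition reconstructing :: "(int \<times> int) set \<Rightarrow> int \<times> int \<Rightarrow> nat \<Rightarrow> bool" where
  "reconstructing I z M \<longleftrightarrow> (\<forall>p\<in>trig_polys I. sampling_op I z M p = p)"

definition error_op ::
    "(int \<times> int) set \<Rightarrow> int \<times> int \<Rightarrow> nat \<Rightarrow>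
     (real \<times> real \<Rightarrow> complex) \<Rightarrow> real \<times> real \<Rightarrow> complex" where
  "error_op I z M f = (\<lambda>x. f x - sampling_op I z M (continuous_rep f) x)"

end

(*
  The error f - S f has the Fourier coefficients of f outside the box G_R. At k in G_R its coefficient
  is minus the sum of the coefficients of f over the coset of k modulo the dual lattice
  {h. h . z = 0 mod M}, with k left out. Reconstruction means that every translate of G_R contains at
  most one point of each coset. Tile Z^2 by the translates of G_R by L Z^2, L = 2^floor(R); then
  distinct points of a coset lie in distinct tiles, and a point in the tile a, a not 0, has mixed weight
  at least a constant times L^2 times that of a. Hence the inverse weights over a coset without its
  point in G_R sum to O(L^(-2 alpha)) (the sum over all tiles converges because alpha > 1/2), and
  Cauchy-Schwarz together with disjointness of the cosets gives the upper bound. A single character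
  just outside G_R gives the lower bound.

  Expressing the samples of f by its Fourier coefficients needs the continuous representative of f to
  be its Fourier series, that is, uniqueness of Fourier coefficients: by Stone-Weierstrass an
  integrable function with vanishing coefficients integrates to 0 over compact sets, hence vanishes
  by inner regularity.
*)
theory Submission imports Defs begin

section \<open>Characters of the torus\<close>

lemma character_eq_cis: "character k x = cis (2 * pi * pairing k x)"
  by (simp add: character_def cis_conv_exp mult_ac)

lemma pairing_add: "pairing (k + l) x = pairing k x + pairing l x"
  and pairing_minus: "pairing (- k) x = - pairing k x"
  by (simp_all add: pairing_def algebra_simps)

lemma character_add: "character (k + l) x = character k x * character l x"
  by (simp add: character_eq_cis pairing_add cis_mult distrib_left)

lemma character_minus: "character (- k) x = exp (- 2 * of_real pi * \<i> * of_real (pairing k x))"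
  by (simp add: character_def pairing_minus)

lemma norm_character [simp]: "cmod (character k x) = 1"
  by (simp add: character_eq_cis)

lemma character_0 [simp]: "character 0 x = 1"
  by (simp add: character_eq_cis pairing_def)

lemma continuous_on_character [continuous_intros]: "continuous_on A (character k)"
  unfolding character_def pairing_def by (intro continuous_intros)

lemma borel_measurable_character [measurable]: "character k \<in> borel_measurable borel"
  by (intro borel_measurable_continuous_onI continuous_on_character)

lemma periodic2_character: "periodic2 (character k)"
proof -
  have "character k (x + 1, y) = character k (x, y)" "character k (x, y + 1) = character k (x, y)" for x y
  proof -
    have "character k (x + 1, y) = character k (x, y) * cis (2 * pi * of_int (fst k))"
      "character k (x, y + 1) = character k (x, y) * cis (2 * pi * of_int (snd k))"
      by (simp_all add: character_eq_cis pairing_def cis_mult algebra_simps)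
    then show "character k (x + 1, y) = character k (x, y)" "character k (x, y + 1) = character k (x, y)"
      by (simp_all add: cis_multiple_2pi)
  qed
  then show ?thesis by (simp add: periodic2_def)
qed

section \<open>Integration over the unit square and orthogonality of characters\<close>

lemma unit_square_borel [measurable]: "unit_square \<in> sets borel"
  unfolding unit_square_def borel_prod [symmetric] by (intro pair_measureI) simp_all

lemma emeasure_unit_square: "emeasure lborel unit_square = 1"
proof -
  have "emeasure (lborel \<Otimes>\<^sub>M lborel) ({0..<1::real} \<times> {0..<1::real}) = 1"
    by (subst lborel.emeasure_pair_measure_Times) simp_all
  then show ?thesis by (simp add: unit_square_def lborel_prod)
qed

lemma fourier_coeff_character_form:
  "fourier_coeff f k = (LINT x:unit_square|lborel. f x * character (- k) x)"
  by (simp only: fourier_coeff_def character_minus)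

lemma set_integrable_mult_bounded:
  fixes h v :: "'a \<Rightarrow> complex"
  assumes h: "set_integrable M S h" and S: "S \<in> sets M" and [measurable]: "v \<in> borel_measurable M"
    and B: "\<And>x. x \<in> S \<Longrightarrow> cmod (v x) \<le> B"
  shows "set_integrable M S (\<lambda>x. h x * v x)"
proof -
  have "set_integrable M S (\<lambda>x. of_real B * h x)"
    using h by simp
  then show ?thesis
  proof (rule set_integrable_bound)
    \<comment> \<open>Only \<open>h\<close> cut off by \<open>S\<close> is known to be measurable,
      so the indicator is grouped with \<open>h\<close> before multiplying by
      \<open>v\<close>.\<close>
    have "(\<lambda>x. (indicat_real S x *\<^sub>R h x) * v x) \<in> borel_measurable M"
      using h unfolding set_integrable_def by measurable
    then show "set_borel_measurable M S (\<lambda>x. h x * v x)"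
      unfolding set_borel_measurable_def by simp
    have "cmod (h x * v x) \<le> cmod (of_real B * h x)" if "x \<in> S" for x
    proof -
      have "cmod (v x) \<le> \<bar>B\<bar>" using B[OF that] by linarith
      then show ?thesis by (simp add: norm_mult mult.commute[of "\<bar>B\<bar>"] mult_left_mono)
    qed
    then show "AE x in M. x \<in> S \<longrightarrow> cmod (h x * v x) \<le> cmod (of_real B * h x)" by simp
  qed
qed

text \<open>The two integrals differ by at most the supremum of \<open>cmod (u n x - v x)\<close>
  over \<open>S\<close> times the L1 norm of \<open>h\<close> on \<open>S\<close>. The filter is
  left open to serve both polynomial approximation along \<open>sequentially\<close> and Fourier
  partial sums along finite sets of frequencies.\<close>

lemma set_integral_mult_uniform_limit:
  fixes h :: "'a::euclidean_space \<Rightarrow> complex"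
  assumes h: "set_integrable M S h"
    and u: "\<And>n. set_integrable M S (\<lambda>x. h x * u n x)"
    and v: "set_integrable M S (\<lambda>x. h x * v x)"
    and lim: "uniform_limit S u v F"
  shows "((\<lambda>n. LINT x:S|M. h x * u n x) \<longlongrightarrow> (LINT x:S|M. h x * v x)) F"
proof (rule tendstoI)
  fix e :: real assume "e > 0"
  define I where "I = (LINT x:S|M. cmod (h x))"
  have nh: "set_integrable M S (\<lambda>x. cmod (h x))"
    using integrable_norm[OF h[unfolded set_integrable_def]] by (simp add: set_integrable_def)
  have "I \<ge> 0" unfolding I_def set_lebesgue_integral_def by (intro integral_nonneg_AE) auto
  \<comment> \<open>The added 1 avoids division by zero and makes \<open>d * I < e\<close>
    strict.\<close>
  define d where "d = e / (I + 1)"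
  have "d > 0" using \<open>e > 0\<close> \<open>I \<ge> 0\<close> by (simp add: d_def)
  have "d * I < e" using \<open>e > 0\<close> \<open>I \<ge> 0\<close> by (simp add: d_def field_simps)
  from uniform_limitD[OF lim \<open>d > 0\<close>]
  show "\<forall>\<^sub>F n in F. dist (LINT x:S|M. h x * u n x) (LINT x:S|M. h x * v x) < e"
  proof eventually_elim
    case (elim n)
    have "(LINT x:S|M. h x * u n x) - (LINT x:S|M. h x * v x) = (LINT x:S|M. h x * u n x - h x * v x)"
      using u v by simp
    also have "cmod \<dots> \<le> (LINT x:S|M. d * cmod (h x))"
      unfolding set_lebesgue_integral_def
    proof (rule Bochner_Integration.integral_norm_bound_integral)
      show "integrable M (\<lambda>x. indicat_real S x *\<^sub>R (h x * u n x - h x * v x))"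
        using set_integral_diff(1)[OF u v] by (simp add: set_integrable_def)
      show "integrable M (\<lambda>x. indicat_real S x *\<^sub>R (d * cmod (h x)))"
        using set_integrable_mult_right[of d, OF nh] by (simp add: set_integrable_def)
      show "cmod (indicat_real S x *\<^sub>R (h x * u n x - h x * v x))
          \<le> indicat_real S x *\<^sub>R (d * cmod (h x))" for x
      proof (cases "x \<in> S")
        case True
        then have "cmod (h x * (u n x - v x)) \<le> d * cmod (h x)"
          using elim by (simp add: norm_mult dist_norm mult.commute[of d] mult_left_mono less_imp_le)
        with True show ?thesis by (simp add: right_diff_distrib)
      qed simp
    qed
    also have "\<dots> = d * I" by (simp add: I_def)
    finally show ?case using \<open>d * I < e\<close> by (simp add: dist_norm)
  qed
qed

lemma integral_cis_unit_interval:
  "(\<integral>t. indicat_real {0..<1} t *\<^sub>R cis (2 * pi * of_int n * t) \<partial>lborel) = (if n = 0 then 1 else 0)"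
proof -
  \<comment> \<open>Closing the interval adds a single point and brings the integral into the form
    of the fundamental theorem of calculus.\<close>
  have "(\<integral>t. indicat_real {0..<1} t *\<^sub>R cis (2 * pi * of_int n * t) \<partial>lborel)
      = (\<integral>t. indicat_real {0..1} t *\<^sub>R cis (2 * pi * of_int n * t) \<partial>lborel)"
  proof (rule integral_cong_AE)
    have [measurable]: "(\<lambda>t. cis (2 * pi * of_int n * t)) \<in> borel_measurable borel"
      by (intro borel_measurable_continuous_onI continuous_intros)
    show "(\<lambda>t. indicat_real {0..<1} t *\<^sub>R cis (2 * pi * of_int n * t)) \<in> borel_measurable lborel"
      "(\<lambda>t. indicat_real {0..1} t *\<^sub>R cis (2 * pi * of_int n * t)) \<in> borel_measurable lborel"
      by simp_all
    show "AE t in lborel. indicat_real {0..<1} t *\<^sub>R cis (2 * pi * of_int n * t) =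
        indicat_real {0..1} t *\<^sub>R cis (2 * pi * of_int n * t)"
      using AE_lborel_singleton[of 1] by eventually_elim (auto simp: indicator_def)
  qed
  also have "\<dots> = (if n = 0 then 1 else 0)"
  proof (cases "n = 0")
    case True
    then show ?thesis by simp
  next
    case False
    define w where "w = 2 * pi * of_int n"
    have "w \<noteq> 0" using False by (simp add: w_def)
    have "(\<integral>t. indicat_real {0..1} t *\<^sub>R cis (w * t) \<partial>lborel)
        = cis (w * 1) / (\<i> * w) - cis (w * 0) / (\<i> * w)"
    proof (rule integral_FTC_Icc)
      show "((\<lambda>t. cis (w * t) / (\<i> * w)) has_vector_derivative cis (w * t)) (at t within {0..1})" for t
      proof -
        have "((\<lambda>z. exp (\<i> * of_real w * z) / (\<i> * w)) has_field_derivative exp (\<i> * of_real w * of_real t))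
            (at (of_real t))"
          by (rule derivative_eq_intros refl | simp add: \<open>w \<noteq> 0\<close>)+
        from has_vector_derivative_real_field[OF this] show ?thesis
          by (simp add: cis_conv_exp mult.assoc)
      qed
    qed (intro continuous_intros | simp)+
    also have "\<dots> = 0" by (simp add: w_def cis_multiple_2pi)
    finally show ?thesis using False by (simp add: w_def)
  qed
  finally show ?thesis .
qed

lemma set_integrable_unit_square_bounded:
  assumes [measurable]: "f \<in> borel_measurable borel" and "\<And>x. cmod (f x) \<le> B"
  shows "set_integrable lborel unit_square f"
proof -
  have "set_integrable lborel unit_square (\<lambda>x. 1 :: complex)"
    unfolding set_integrable_def by (rule integrable_scaleR_left) (simp add: emeasure_unit_square)
  from set_integrable_mult_bounded[OF this, of f B] assms show ?thesis by simp
qed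

text \<open>Fubini splits the integral into one-dimensional integrals for \<open>fst k\<close> and
  \<open>snd k\<close>. Applied to \<open>k - l\<close>, this is the orthonormality of
  characters.\<close>

lemma integral_character:
  "(LINT x:unit_square|lborel. character k x) = (if k = 0 then 1 else 0)"
proof -
  let ?e = "\<lambda>n t. indicat_real {0..<1} t *\<^sub>R cis (2 * pi * of_int n * t)"
  have eq: "indicat_real unit_square (x, y) *\<^sub>R character k (x, y) = ?e (fst k) x * ?e (snd k) y" for x y
    by (auto simp: indicator_def unit_square_def character_eq_cis pairing_def cis_mult algebra_simps)
  have "integrable (lborel \<Otimes>\<^sub>M lborel) (\<lambda>x. indicat_real unit_square x *\<^sub>R character k x)"
    using set_integrable_unit_square_bounded[of "character k" 1]
    by (simp add: set_integrable_def lborel_prod)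
  from lborel_pair.integral_fst'[OF this]
  have "(LINT x:unit_square|lborel. character k x) =
      (\<integral>x. (\<integral>y. ?e (fst k) x * ?e (snd k) y \<partial>lborel) \<partial>lborel)"
    by (simp add: set_lebesgue_integral_def lborel_prod eq)
  also have "\<dots> = (if fst k = 0 then 1 else 0) * (if snd k = 0 then 1 else 0)"
    by (simp only: integral_mult_right_zero integral_mult_left_zero integral_cis_unit_interval)
  finally show ?thesis by (simp add: prod_eq_iff)
qed

lemma fourier_coeff_character: "fourier_coeff (character k) l = (if k = l then 1 else 0)"
  using integral_character[of "k - l"] by (simp add: fourier_coeff_character_form flip: character_add)

section \<open>Uniqueness of Fourier coefficients\<close>

text \<open>Integrability is part of the notion: the integral of a non-integrable function is 0 by
  convention, so vanishing coefficients alone would say nothing.\<close>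

definition coeff_free :: "(real \<times> real \<Rightarrow> complex) \<Rightarrow> bool" where
  "coeff_free h \<longleftrightarrow> set_integrable lborel unit_square h \<and> (\<forall>k. fourier_coeff h k = 0)"

lemma set_integrable_mult_character:
  assumes "set_integrable lborel unit_square h"
  shows "set_integrable lborel unit_square (\<lambda>x. h x * character k x)"
  using assms by (rule set_integrable_mult_bounded[where B=1]) simp_all

lemma fourier_coeff_mult_character:
  "fourier_coeff (\<lambda>x. h x * character k x) l = fourier_coeff h (l - k)"
proof -
  have "character (- (l - k)) x = character k x * character (- l) x" for x
    by (simp flip: character_add)
  then show ?thesis by (simp add: fourier_coeff_character_form mult.assoc)
qed

lemma fourier_coeff_add:
  assumes "set_integrable lborel unit_square f" "set_integrable lborel unit_square g"
  shows "fourier_coeff (\<lambda>x. f x + g x) k = fourier_coeff f k + fourier_coeff g k"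
  using set_integral_add(2)[OF assms[THEN set_integrable_mult_character]]
  by (simp add: fourier_coeff_character_form distrib_right)

lemma fourier_coeff_diff:
  assumes "set_integrable lborel unit_square f" "set_integrable lborel unit_square g"
  shows "fourier_coeff (\<lambda>x. f x - g x) k = fourier_coeff f k - fourier_coeff g k"
  using set_integral_diff(2)[OF assms[THEN set_integrable_mult_character]]
  by (simp add: fourier_coeff_character_form left_diff_distrib)

lemma fourier_coeff_cmult: "fourier_coeff (\<lambda>x. c * f x) k = c * fourier_coeff f k"
  by (simp add: fourier_coeff_character_form mult.assoc)

lemma coeff_free_add: "coeff_free f \<Longrightarrow> coeff_free g \<Longrightarrow> coeff_free (\<lambda>x. f x + g x)"
  by (simp add: coeff_free_def fourier_coeff_add set_integral_add(1))

lemma coeff_free_cmult: "coeff_free f \<Longrightarrow> coeff_free (\<lambda>x. c * f x)"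
  by (simp add: coeff_free_def fourier_coeff_cmult)

text \<open>Modulation by a character merely shifts the coefficients, so the vanishing of all of
  them persists.\<close>

lemma coeff_free_mult_character: "coeff_free f \<Longrightarrow> coeff_free (\<lambda>x. f x * character k x)"
  by (simp add: coeff_free_def fourier_coeff_mult_character set_integrable_mult_character
      del: split_paired_All)

section \<open>Stone-Weierstrass on the torus embedded as a product of two unit circles\<close>

definition torus_map :: "real \<times> real \<Rightarrow> complex \<times> complex" where
  "torus_map x = (character (1, 0) x, character (0, 1) x)"

lemma continuous_on_torus_map [continuous_intros]: "continuous_on A torus_map"
  unfolding torus_map_def[abs_def] by (intro continuous_intros)

lemma of_real_Re_character: "of_real (Re (character k x)) = (character k x + character (- k) x) / 2"
  and of_real_Im_character: "of_real (Im (character k x)) = (character k x - character (- k) x) / (2 * \<i>)"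
  by (simp_all add: character_eq_cis pairing_minus complex_eq_iff Re_divide Im_divide)

lemma coeff_free_mult_Re_Im:
  assumes "coeff_free h"
  shows "coeff_free (\<lambda>x. h x * of_real (Re (character k x)))"
    and "coeff_free (\<lambda>x. h x * of_real (Im (character k x)))"
proof -
  have *: "coeff_free (\<lambda>x. a * (h x * character k x) + b * (h x * character (- k) x))" for a b
    by (intro coeff_free_add coeff_free_cmult coeff_free_mult_character assms)
  show "coeff_free (\<lambda>x. h x * of_real (Re (character k x)))"
    using *[of "1/2" "1/2"] by (simp add: of_real_Re_character field_simps)
  show "coeff_free (\<lambda>x. h x * of_real (Im (character k x)))"
    using *[of "1/(2*\<i>)" "-1/(2*\<i>)"] by (simp add: of_real_Im_character field_simps)
qed

text \<open>By Euler's formulas the real and imaginary parts of the two coordinates of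
  \<open>torus_map\<close> are combinations of characters; induction then reaches all polynomials in
  them. The function \<open>h\<close> varies in the induction for the sake of products.\<close>

lemma coeff_free_mult_polynomial:
  assumes "real_polynomial_function p" "coeff_free h"
  shows "coeff_free (\<lambda>x. h x * of_real (p (torus_map x)))"
  using assms
proof (induction arbitrary: h)
  case (linear f)
  interpret bounded_linear f by fact
  \<comment> \<open>A real-linear functional on pairs of complex numbers is determined by its values
    at four real basis vectors.\<close>
  have f_eq: "f (u, v) = Re u * f (1, 0) + Im u * f (\<i>, 0) + Re v * f (0, 1) + Im v * f (0, \<i>)" for u v
  proof -
    have "(u, v) = Re u *\<^sub>R (1, 0) + Im u *\<^sub>R (\<i>, 0) + Re v *\<^sub>R (0, 1) + Im v *\<^sub>R (0, \<i>)"
      by (simp add: complex_eq_iff)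
    then show ?thesis by (simp only: add scaleR real_scaleR_def)
  qed
  have "f (torus_map x) = Re (character (1, 0) x) * f (1, 0) + Im (character (1, 0) x) * f (\<i>, 0)
      + Re (character (0, 1) x) * f (0, 1) + Im (character (0, 1) x) * f (0, \<i>)" for x
    unfolding torus_map_def by (rule f_eq)
  then have "(\<lambda>x. h x * of_real (f (torus_map x))) = (\<lambda>x.
      of_real (f (1, 0)) * (h x * of_real (Re (character (1, 0) x))) +
      of_real (f (\<i>, 0)) * (h x * of_real (Im (character (1, 0) x))) +
      of_real (f (0, 1)) * (h x * of_real (Re (character (0, 1) x))) +
      of_real (f (0, \<i>)) * (h x * of_real (Im (character (0, 1) x))))"
    by (simp add: algebra_simps)
  moreover have "coeff_free \<dots>"
    by (intro coeff_free_add coeff_free_cmult coeff_free_mult_Re_Im linear.prems)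
  ultimately show ?case by (simp only:)
next
  case (const c)
  then show ?case using coeff_free_cmult[of h "of_real c"] by (simp add: mult.commute)
next
  case (add f g)
  then have "coeff_free (\<lambda>x. h x * of_real (f (torus_map x)) + h x * of_real (g (torus_map x)))"
    by (intro coeff_free_add) auto
  then show ?case by (simp add: distrib_left)
next
  case (mult f g)
  \<comment> \<open>The induction hypothesis for \<open>g\<close> is applied to the product of
    \<open>h\<close> with \<open>f\<close>, which is covered by the hypothesis for
    \<open>f\<close>.\<close>
  then have "coeff_free (\<lambda>x. (h x * of_real (f (torus_map x))) * of_real (g (torus_map x)))"
    by blast
  then show ?case by (simp add: mult.assoc)
qed

text \<open>Polynomials integrate to 0 against \<open>h\<close> and approximate \<open>F\<close>
  uniformly on a compact set containing all values of \<open>torus_map\<close>, so the vanishing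
  passes to the limit.\<close>

lemma integral_mult_continuous_eq_0:
  assumes h: "coeff_free h" and cont: "continuous_on UNIV (F :: complex \<times> complex \<Rightarrow> real)"
  shows "(LINT x:unit_square|lborel. h x * of_real (F (torus_map x))) = 0"
proof -
  define T where "T = cball (0::complex) 1 \<times> cball (0::complex) 1"
  have T: "compact T" unfolding T_def by (intro compact_Times compact_cball)
  have inT: "torus_map x \<in> T" for x by (simp add: T_def torus_map_def)
  have "\<exists>p. real_polynomial_function p \<and> (\<forall>w\<in>T. \<bar>F w - p w\<bar> < 1 / Suc n)" for n
    using Stone_Weierstrass_real_polynomial_function[OF T continuous_on_subset[OF cont subset_UNIV], of "1 / Suc n"]
    by (metis zero_less_divide_1_iff of_nat_0_less_iff zero_less_Suc)
  then obtain p where p: "\<And>n. real_polynomial_function (p n)"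
    and pF: "\<And>n w. w \<in> T \<Longrightarrow> \<bar>F w - p n w\<bar> < 1 / Suc n"
    by metis
  define u where "u = (\<lambda>n x. complex_of_real (p n (torus_map x)))"
  have free: "coeff_free (\<lambda>x. h x * u n x)" for n
    unfolding u_def by (rule coeff_free_mult_polynomial[OF p h])
  have "(\<lambda>n. LINT x:unit_square|lborel. h x * u n x) \<longlonglongrightarrow>
      (LINT x:unit_square|lborel. h x * of_real (F (torus_map x)))"
  proof (rule set_integral_mult_uniform_limit)
    show "set_integrable lborel unit_square h" using h by (simp add: coeff_free_def)
    show "set_integrable lborel unit_square (\<lambda>x. h x * u n x)" for n
      using free by (simp add: coeff_free_def)
    obtain B where "\<And>w. w \<in> T \<Longrightarrow> \<bar>F w\<bar> \<le> B"
      using compact_imp_bounded[OF compact_continuous_image[OF continuous_on_subset[OF cont subset_UNIV] T]]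
      by (auto simp: bounded_iff)
    with h show "set_integrable lborel unit_square (\<lambda>x. h x * complex_of_real (F (torus_map x)))"
      using inT
      by (intro set_integrable_mult_bounded[where B=B])
        (auto simp: coeff_free_def intro!: borel_measurable_continuous_onI continuous_intros
            continuous_on_compose2[OF cont])
    show "uniform_limit unit_square u (\<lambda>x. of_real (F (torus_map x))) sequentially"
    proof (rule uniform_limitI)
      fix e :: real assume "e > 0"
      then obtain N where N: "inverse (real (Suc N)) < e" using reals_Archimedean by blast
      show "\<forall>\<^sub>F n in sequentially. \<forall>x\<in>unit_square. dist (u n x) (of_real (F (torus_map x))) < e"
        using eventually_ge_at_top[of N]
      proof eventually_elim
        case (elim n)
        have "1 / real (Suc n) \<le> inverse (real (Suc N))"
          using elim by (simp add: field_simps)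
        then have "\<bar>F (torus_map x) - p n (torus_map x)\<bar> < e" for x
          using N pF[of "torus_map x" n] inT[of x] by linarith
        then show ?case
          unfolding u_def dist_of_real dist_real_def by (simp add: abs_minus_commute)
      qed
    qed
  qed
  \<comment> \<open>The plain integral is the Fourier coefficient at frequency 0.\<close>
  moreover have "(LINT x:unit_square|lborel. h x * u n x) = 0" for n
    using free[of n, unfolded coeff_free_def, THEN conjunct2, rule_format, of 0]
    by (simp add: fourier_coeff_character_form)
  ultimately show ?thesis by (simp add: LIMSEQ_const_iff)
qed

text \<open>Coordinates with the same image differ by an integer, and the half-open interval keeps
  this integer below 1 in absolute value.\<close>

lemma inj_on_torus_map: "inj_on torus_map unit_square"
proof -
  have inj: "s = t" if "cis (2 * pi * s) = cis (2 * pi * t)" "0 \<le> s" "s < 1" "0 \<le> t" "t < 1" for s t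
  proof -
    from that(1) have "exp (\<i> * of_real (2 * pi * s)) = exp (\<i> * of_real (2 * pi * t))"
      by (simp add: cis_conv_exp)
    then obtain n :: int where "\<i> * of_real (2 * pi * s) = \<i> * of_real (2 * pi * t) + (of_int (2 * n) * pi) * \<i>"
      unfolding exp_eq by blast
    from arg_cong[OF this, of Im] have "2 * pi * s = 2 * pi * t + 2 * of_int n * pi" by simp
    then have "2 * pi * (s - t) = 2 * pi * of_int n" by (simp add: algebra_simps)
    then have "s - t = of_int n" by simp
    moreover have "\<bar>s - t\<bar> < 1" using that by linarith
    ultimately have "real_of_int \<bar>n\<bar> < 1" by simp
    then have "n = 0" by linarith
    with \<open>s - t = of_int n\<close> show "s = t" by simp
  qed
  show ?thesis
    by (auto simp: inj_on_def torus_map_def character_eq_cis pairing_def unit_square_def intro: inj)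
qed

text \<open>
  Injectivity of \<open>torus_map\<close> on the square makes \<open>K\<close> the preimage of a compact set; its indicator is
  the limit of the powers of a continuous function of \<open>torus_map\<close>, namely \<open>1 / (1 + d)\<close> with \<open>d\<close> the
  distance to that set.
\<close>

lemma coeff_free_integral_compact:
  assumes h: "coeff_free h" and K: "compact K" "K \<subseteq> unit_square"
  shows "(LINT x:K|lborel. h x) = 0"
proof (cases "K = {}")
  case True
  then show ?thesis by (simp add: set_lebesgue_integral_def)
next
  case False
  define d where "d = (\<lambda>x. infdist (torus_map x) (torus_map ` K))"
  have d0: "d x \<ge> 0" for x by (simp add: d_def infdist_nonneg)
  have C: "closed (torus_map ` K)"
    by (intro compact_imp_closed compact_continuous_image continuous_intros K)
  have d_eq_0: "d x = 0 \<longleftrightarrow> x \<in> K" if "x \<in> unit_square" for x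
  proof -
    have "d x = 0 \<longleftrightarrow> torus_map x \<in> torus_map ` K"
      using in_closed_iff_infdist_zero[OF C] False by (auto simp: d_def)
    also have "\<dots> \<longleftrightarrow> x \<in> K"
      using inj_on_image_mem_iff[OF inj_on_torus_map that K(2)] .
    finally show ?thesis .
  qed
  have contd: "continuous_on UNIV d" unfolding d_def by (intro continuous_intros)
  have [measurable]: "d \<in> borel_measurable borel" by (rule borel_measurable_continuous_onI[OF contd])
  have hi: "integrable lborel (\<lambda>x. indicat_real unit_square x *\<^sub>R h x)"
    using h by (simp add: coeff_free_def set_integrable_def)
  have Kb [measurable]: "K \<in> sets borel" using K(1) by (simp add: borel_compact)
  let ?w = "\<lambda>n x. complex_of_real ((1 / (1 + d x)) ^ n)"
  have "(\<lambda>n. LINT x:unit_square|lborel. h x * ?w n x) \<longlonglongrightarrow> (LINT x:K|lborel. h x)"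
    unfolding set_lebesgue_integral_def
  proof (rule integral_dominated_convergence)
    show "integrable lborel (\<lambda>x. norm (indicat_real unit_square x *\<^sub>R h x))"
      using hi by (rule integrable_norm)
    have "(\<lambda>x. indicat_real K x *\<^sub>R (indicat_real unit_square x *\<^sub>R h x)) \<in> borel_measurable lborel"
      using borel_measurable_integrable[OF hi] by measurable
    also have "(\<lambda>x. indicat_real K x *\<^sub>R (indicat_real unit_square x *\<^sub>R h x)) =
        (\<lambda>x. indicat_real K x *\<^sub>R h x)"
      using K(2) by (intro ext) (auto simp: indicator_def)
    finally show "(\<lambda>x. indicat_real K x *\<^sub>R h x) \<in> borel_measurable lborel" .
    have "(\<lambda>x. (indicat_real unit_square x *\<^sub>R h x) * ?w n x) \<in> borel_measurable lborel" for n
      using borel_measurable_integrable[OF hi] by measurable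
    then show "(\<lambda>x. indicat_real unit_square x *\<^sub>R (h x * ?w n x)) \<in> borel_measurable lborel" for n
      by simp
    show "AE x in lborel. norm (indicat_real unit_square x *\<^sub>R (h x * ?w n x))
        \<le> norm (indicat_real unit_square x *\<^sub>R h x)" for n
    proof (rule AE_I2)
      fix x
      have "0 \<le> (1 / (1 + d x)) ^ n" "(1 / (1 + d x)) ^ n \<le> 1"
        using d0[of x] by (auto intro!: power_le_one)
      then show "norm (indicat_real unit_square x *\<^sub>R (h x * ?w n x))
          \<le> norm (indicat_real unit_square x *\<^sub>R h x)"
        by (auto simp: indicator_def norm_mult mult_left_le simp del: power_one_over of_real_power)
    qed
    show "AE x in lborel. (\<lambda>n. indicat_real unit_square x *\<^sub>R (h x * ?w n x)) \<longlonglongrightarrow> indicat_real K x *\<^sub>R h x"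
    proof (rule AE_I2)
      fix x
      consider "x \<notin> unit_square" | "x \<in> K" "x \<in> unit_square" | "x \<in> unit_square" "x \<notin> K" by blast
      then show "(\<lambda>n. indicat_real unit_square x *\<^sub>R (h x * ?w n x)) \<longlonglongrightarrow> indicat_real K x *\<^sub>R h x"
      proof cases
        case 1
        with K(2) show ?thesis by (auto simp: indicator_def)
      next
        case 2
        then have "d x = 0" using d_eq_0 by simp
        with 2 show ?thesis by simp
      next
        case 3
        then have "d x > 0" using d_eq_0[of x] d0[of x] by force
        then have "(\<lambda>n. (1 / (1 + d x)) ^ n) \<longlonglongrightarrow> 0" by (intro LIMSEQ_realpow_zero) auto
        then have "(\<lambda>n. h x * ?w n x) \<longlonglongrightarrow> h x * of_real 0"
          by (intro tendsto_mult tendsto_const tendsto_of_real)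
        with 3 show ?thesis by simp
      qed
    qed
  qed
  moreover have "(LINT x:unit_square|lborel. h x * ?w n x) = 0" for n
  proof -
    have "continuous_on UNIV (\<lambda>w. (1 / (1 + infdist w (torus_map ` K))) ^ n)"
      by (intro continuous_intros) (metis infdist_nonneg add_nonneg_eq_0_iff zero_le_one zero_neq_one)
    from integral_mult_continuous_eq_0[OF h this] show ?thesis by (simp add: d_def)
  qed
  ultimately show ?thesis by (simp add: LIMSEQ_const_iff)
qed

section \<open>From compact sets to almost every point\<close>

lemma AE_nonpos_of_integral_compact:
  fixes v :: "real \<times> real \<Rightarrow> real"
  assumes [measurable]: "v \<in> borel_measurable borel" "S \<in> sets borel" and fin: "emeasure lborel S < \<infinity>"
    and vi: "set_integrable lborel S v"
    and zero: "\<And>K. compact K \<Longrightarrow> K \<subseteq> S \<Longrightarrow> (LINT x:K|lborel. v x) \<le> 0"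
  shows "AE x in lborel. x \<in> S \<longrightarrow> v x \<le> 0"
proof -
  \<comment> \<open>If \<open>B\<close> had positive measure, inner regularity would place in it a
    compact set of positive measure; but \<open>zero\<close> makes every compact subset of
    \<open>B\<close> null.\<close>
  define B where "B = {x \<in> S. v x > 0}"
  have Bb [measurable]: "B \<in> sets borel"
  proof -
    have "B = S \<inter> {x \<in> space borel. v x > 0}" by (auto simp: B_def)
    also have "\<dots> \<in> sets borel" by measurable
    finally show ?thesis .
  qed
  \<comment> \<open>Restricting Lebesgue measure to \<open>S\<close> makes it finite on the whole
    plane, as inner regularity requires.\<close>
  define D where "D = density lborel (indicator S :: _ \<Rightarrow> ennreal)"
  have D: "emeasure D A = emeasure lborel (S \<inter> A)" if "A \<in> sets borel" for A
    using that by (simp add: D_def emeasure_density flip: indicator_inter_arith)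
  have null: "emeasure lborel K = 0" if K: "compact K" "K \<subseteq> B" for K
  proof -
    have [measurable]: "K \<in> sets borel" using K(1) by (simp add: borel_compact)
    have KS: "K \<subseteq> S" using K(2) by (auto simp: B_def)
    have Ki: "set_integrable lborel K v" by (rule set_integrable_subset[OF vi]) (use KS in auto)
    have nn: "0 \<le> indicat_real K x *\<^sub>R v x" for x using K(2) by (auto simp: indicator_def B_def)
    \<comment> \<open>The integral is at most 0 by \<open>zero\<close> and at least 0 because
      \<open>v\<close> is positive on \<open>K\<close>.\<close>
    have "(LINT x:K|lborel. v x) = 0"
      using zero[OF K(1) KS] unfolding set_lebesgue_integral_def
      by (intro antisym integral_nonneg_AE AE_I2 nn) auto
    then have "AE x in lborel. indicat_real K x *\<^sub>R v x = 0"
      using Ki nn unfolding set_lebesgue_integral_def set_integrable_def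
      by (subst (asm) integral_nonneg_eq_0_iff_AE) auto
    then have "AE x in lborel. x \<notin> K"
      by eventually_elim (use K(2) in \<open>auto simp: indicator_def B_def\<close>)
    then show ?thesis by (subst (asm) AE_iff_measurable[of K]) auto
  qed
  have "emeasure D B = (SUP K \<in> {K. K \<subseteq> B \<and> compact K}. emeasure D K)"
    using fin by (intro inner_regular) (auto simp: D_def emeasure_density)
  also have "\<dots> = (SUP K \<in> {K. K \<subseteq> B \<and> compact K}. 0)"
  proof (intro SUP_cong refl)
    fix K assume "K \<in> {K. K \<subseteq> B \<and> compact K}"
    moreover from this have "S \<inter> K = K" by (auto simp: B_def)
    ultimately show "emeasure D K = 0" by (simp add: D borel_compact null)
  qed
  also have "\<dots> = 0" by (rule SUP_const) auto
  finally have "emeasure lborel B = 0"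
    using Bb by (simp add: D) (simp add: B_def inf.absorb2 Int_def)
  then have "AE x in lborel. x \<notin> B" by (subst AE_iff_measurable[of B]) auto
  then show ?thesis by eventually_elim (auto simp: B_def)
qed

lemma coeff_free_AE_zero:
  assumes [measurable]: "h \<in> borel_measurable borel" and h: "coeff_free h"
  shows "AE x in lborel. x \<in> unit_square \<longrightarrow> h x = 0"
proof -
  have hi: "set_integrable lborel unit_square h" using h by (simp add: coeff_free_def)
  have *: "AE x in lborel. x \<in> unit_square \<longrightarrow> Re (c * h x) \<le> 0" for c
  proof (rule AE_nonpos_of_integral_compact)
    have Re_int: "set_integrable lborel K (\<lambda>x. Re (c * h x)) \<and>
        (LINT x:K|lborel. Re (c * h x)) = Re (c * (LINT x:K|lborel. h x))"
      if "set_integrable lborel K h" for K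
    proof -
      have "set_integrable lborel K (\<lambda>x. c * h x)" using that by simp
      then have i: "integrable lborel (\<lambda>x. indicat_real K x *\<^sub>R (c * h x))" by (simp add: set_integrable_def)
      have "set_integrable lborel K (\<lambda>x. Re (c * h x))"
        using integrable_Re[OF i] by (simp add: set_integrable_def)
      moreover have "(LINT x:K|lborel. Re (c * h x)) = Re (LINT x:K|lborel. c * h x)"
        using integral_Re[OF i] unfolding set_lebesgue_integral_def scaleR_complex.sel(1) real_scaleR_def .
      ultimately show ?thesis by (simp only: set_integral_mult_right)
    qed
    show "set_integrable lborel unit_square (\<lambda>x. Re (c * h x))" using Re_int[OF hi] by simp
    show "(LINT x:K|lborel. Re (c * h x)) \<le> 0" if K: "compact K" "K \<subseteq> unit_square" for K
    proof -
      have "set_integrable lborel K h"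
        by (rule set_integrable_subset[OF hi]) (use K in \<open>auto simp: borel_compact\<close>)
      with coeff_free_integral_compact[OF h K] show ?thesis using Re_int by simp
    qed
  qed (simp_all add: emeasure_unit_square)
  \<comment> \<open>Multiplication by \<open>\<i>\<close> turns the imaginary part into a real part
    up to sign, so the four inequalities force both parts of \<open>h x\<close> to be 0.\<close>
  from *[of 1] *[of "-1"] *[of \<i>] *[of "-\<i>"] show ?thesis
    by eventually_elim (auto simp: complex_eq_iff)
qed

text \<open>The plane is a countable union of integer translates of the square, and translates of a
  null set are null.\<close>

lemma AE_periodic_extension:
  assumes [measurable]: "h \<in> borel_measurable borel" and per: "periodic2 (h :: real \<times> real \<Rightarrow> complex)"
    and zero: "AE x in lborel. x \<in> unit_square \<longrightarrow> h x = 0"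
  shows "AE x in lborel. h x = 0"
proof -
  have shift: "h (x + of_int m, y + of_int n) = h (x, y)" for x y m n
  proof -
    have X: "h (x + of_int m, y) = h (x, y)" for x y m
    proof -
      interpret periodic_fun_simple' "\<lambda>x. h (x, y)"
        using per by unfold_locales (simp add: periodic2_def)
      show ?thesis using plus_of_int[of x m] by simp
    qed
    have Y: "h (x, y + of_int n) = h (x, y)" for x y n
    proof -
      interpret periodic_fun_simple' "\<lambda>y. h (x, y)"
        using per by unfold_locales (simp add: periodic2_def)
      show ?thesis using plus_of_int[of y n] by simp
    qed
    show ?thesis by (simp only: X Y)
  qed
  define Z where "Z = {x \<in> unit_square. h x \<noteq> 0}"
  define T where "T = (\<lambda>(m::int, n::int). (real_of_int m, real_of_int n))"
  have Zb: "Z \<in> sets borel"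
  proof -
    have "Z = unit_square \<inter> {x \<in> space borel. h x \<noteq> 0}" by (auto simp: Z_def)
    also have "\<dots> \<in> sets borel" by measurable
    finally show ?thesis .
  qed
  have "AE x in lborel. x \<notin> Z" using zero by eventually_elim (simp add: Z_def)
  then have "emeasure lborel Z = 0" using Zb by (subst (asm) AE_iff_measurable[of Z]) auto
  then have "negligible Z"
    using Zb by (simp add: negligible_iff_null_sets null_sets_completionI null_setsI)
  then have "negligible (\<Union>p\<in>UNIV. (+) (T p) ` Z)"
    by (intro negligible_countable_Union countable_image countableI_type) (auto intro: negligible_translation)
  moreover have "{x. h x \<noteq> 0} \<subseteq> (\<Union>p\<in>UNIV. (+) (T p) ` Z)"
  proof
    fix x assume x: "x \<in> {x. h x \<noteq> 0}"
    obtain a b where ab: "x = (a, b)" by (cases x)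
    have "h (frac a, frac b) = h (a, b)"
      using shift[of "frac a" "\<lfloor>a\<rfloor>" "frac b" "\<lfloor>b\<rfloor>"] by (simp add: frac_def)
    with x ab have "(frac a, frac b) \<in> Z" by (simp add: Z_def unit_square_def frac_lt_1)
    moreover have "x = T (\<lfloor>a\<rfloor>, \<lfloor>b\<rfloor>) + (frac a, frac b)" by (simp add: T_def ab frac_def)
    ultimately show "x \<in> (\<Union>p\<in>UNIV. (+) (T p) ` Z)" by blast
  qed
  ultimately have "negligible {x. h x \<noteq> 0}" by (rule negligible_subset)
  moreover have "{x \<in> space borel. h x \<noteq> 0} \<in> sets borel" by measurable
  ultimately have "{x. h x \<noteq> 0} \<in> null_sets lborel"
    by (simp add: negligible_iff_null_sets null_sets_completion_iff)
  then have "AE x in lborel. x \<notin> {x. h x \<noteq> 0}" by (rule AE_not_in)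
  then show ?thesis by simp
qed

section \<open>Absolutely convergent Fourier series\<close>

text \<open>On a set of finite measure the bound \<open>t \<le> 1 + t\<^sup>2\<close> turns square
  integrability into integrability.\<close>

lemma set_integrable_of_L2_torus:
  assumes "f \<in> L2_torus"
  shows "set_integrable lborel unit_square f"
proof -
  have [measurable]: "f \<in> borel_measurable borel" and
    sq: "set_integrable lborel unit_square (\<lambda>x. (cmod (f x))\<^sup>2)"
    using assms by (auto simp: L2_torus_def)
  have "set_integrable lborel unit_square (\<lambda>x. 1 :: real)"
    unfolding set_integrable_def by (rule integrable_scaleR_left) (simp add: emeasure_unit_square)
  from set_integral_add(1)[OF this sq]
  have "set_integrable lborel unit_square (\<lambda>x. 1 + (cmod (f x))\<^sup>2)" .
  then show ?thesis
  proof (rule set_integrable_bound)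
    have "t \<le> 1 + t\<^sup>2" if "0 \<le> t" for t :: real
      using sum_power2_ge_zero[of "t - 1/2" 0] by (simp add: power2_eq_square algebra_simps)
    then show "AE x in lborel. x \<in> unit_square \<longrightarrow> cmod (f x) \<le> norm (1 + (cmod (f x))\<^sup>2)"
      by (intro AE_I2) auto
  qed (simp add: set_borel_measurable_def)
qed

lemma L2_torus_of_bounded:
  assumes [measurable]: "f \<in> borel_measurable borel" and "periodic2 f" and B: "\<And>x. cmod (f x) \<le> B"
  shows "f \<in> L2_torus"
proof -
  have "set_integrable lborel unit_square (\<lambda>x. B\<^sup>2)"
    unfolding set_integrable_def by (rule integrable_scaleR_left) (simp add: emeasure_unit_square)
  then have "set_integrable lborel unit_square (\<lambda>x. (cmod (f x))\<^sup>2)"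
  proof (rule set_integrable_bound)
    show "AE x in lborel. x \<in> unit_square \<longrightarrow> norm ((cmod (f x))\<^sup>2) \<le> norm (B\<^sup>2)"
      using B by (intro AE_I2) (simp add: power_mono)
  qed (simp add: set_borel_measurable_def)
  with assms show ?thesis by (simp add: L2_torus_def)
qed

lemma L2_torus_diff:
  assumes "f \<in> L2_torus" "g \<in> L2_torus"
  shows "(\<lambda>x. f x - g x) \<in> L2_torus"
proof -
  have [measurable]: "f \<in> borel_measurable borel" "g \<in> borel_measurable borel"
    using assms by (auto simp: L2_torus_def)
  have "set_integrable lborel unit_square (\<lambda>x. 2 * (cmod (f x))\<^sup>2 + 2 * (cmod (g x))\<^sup>2)"
    using assms by (intro set_integral_add(1) set_integrable_mult_right) (auto simp: L2_torus_def)
  then have "set_integrable lborel unit_square (\<lambda>x. (cmod (f x - g x))\<^sup>2)"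
  proof (rule set_integrable_bound)
    have "(cmod (a - b))\<^sup>2 \<le> 2 * (cmod a)\<^sup>2 + 2 * (cmod b)\<^sup>2" for a b
    proof -
      have "(cmod (a - b))\<^sup>2 \<le> (cmod a + cmod b)\<^sup>2"
        by (intro power_mono norm_triangle_ineq4) simp
      also have "\<dots> \<le> 2 * (cmod a)\<^sup>2 + 2 * (cmod b)\<^sup>2"
        using zero_le_power2[of "cmod a - cmod b"] by (simp add: power2_eq_square algebra_simps)
      finally show ?thesis .
    qed
    then show "AE x in lborel. x \<in> unit_square \<longrightarrow>
        norm ((cmod (f x - g x))\<^sup>2) \<le> norm (2 * (cmod (f x))\<^sup>2 + 2 * (cmod (g x))\<^sup>2)"
      by (intro AE_I2) auto
  qed (simp add: set_borel_measurable_def)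
  with assms show ?thesis by (auto simp: L2_torus_def periodic2_def)
qed

lemma set_integrable_character: "set_integrable lborel unit_square (character k)"
  by (rule set_integrable_unit_square_bounded[where B=1]) simp_all

lemma trig_sum_L2_torus:
  assumes "finite I"
  shows "(\<lambda>x. \<Sum>k\<in>I. c k * character k x) \<in> L2_torus"
proof (rule L2_torus_of_bounded)
  show "periodic2 (\<lambda>x. \<Sum>k\<in>I. c k * character k x)"
    using periodic2_character by (simp add: periodic2_def)
  show "cmod (\<Sum>k\<in>I. c k * character k x) \<le> (\<Sum>k\<in>I. cmod (c k))" for x
    by (rule sum_norm_le) (simp add: norm_mult)
qed simp

lemma fourier_coeff_trig_sum:
  assumes "finite I"
  shows "fourier_coeff (\<lambda>x. \<Sum>k\<in>I. c k * character k x) l = (if l \<in> I then c l else 0)"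
  using assms
proof induction
  case empty
  show ?case by (simp add: fourier_coeff_character_form)
next
  case (insert k I)
  have "fourier_coeff (\<lambda>x. c k * character k x + (\<Sum>k\<in>I. c k * character k x)) l =
      c k * fourier_coeff (character k) l + fourier_coeff (\<lambda>x. \<Sum>k\<in>I. c k * character k x) l"
    using insert.hyps(1)
    by (subst fourier_coeff_add)
      (simp_all add: fourier_coeff_cmult set_integrable_character trig_sum_L2_torus set_integrable_of_L2_torus)
  with insert show ?case by (auto simp: fourier_coeff_character)
qed

definition fourier_series :: "(int \<times> int \<Rightarrow> complex) \<Rightarrow> real \<times> real \<Rightarrow> complex" where
  "fourier_series c x = (\<Sum>\<^sub>\<infinity>k. c k * character k x)"

context
  fixes c :: "int \<times> int \<Rightarrow> complex"
  assumes abs_summable: "(\<lambda>k. cmod (c k)) summable_on UNIV"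
begin

lemma fourier_series_has_sum: "((\<lambda>k. c k * character k x) has_sum fourier_series c x) UNIV"
proof -
  have "(\<lambda>k. cmod (c k * character k x)) summable_on UNIV"
    using abs_summable by (simp add: norm_mult)
  from abs_summable_summable[OF this] show ?thesis
    unfolding fourier_series_def by (rule has_sum_infsum)
qed

text \<open>Characters have modulus 1, so \<open>cmod (c k)\<close> is a majorant for the
  Weierstrass test.\<close>

lemma fourier_series_uniform_limit:
  "uniform_limit A (\<lambda>I x. \<Sum>k\<in>I. c k * character k x) (fourier_series c) (finite_subsets_at_top UNIV)"
  unfolding fourier_series_def
  by (rule Weierstrass_m_test_general[OF _ abs_summable]) (simp add: norm_mult)

lemma continuous_on_fourier_series: "continuous_on A (fourier_series c)"
  by (rule uniform_limit_theorem[OF _ fourier_series_uniform_limit])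
    (auto intro!: always_eventually continuous_intros)

lemma periodic2_fourier_series: "periodic2 (fourier_series c)"
  using periodic2_character by (simp add: periodic2_def fourier_series_def)

lemma fourier_series_L2_torus: "fourier_series c \<in> L2_torus"
proof (rule L2_torus_of_bounded)
  show "fourier_series c \<in> borel_measurable borel"
    by (intro borel_measurable_continuous_onI continuous_on_fourier_series)
  show "cmod (fourier_series c x) \<le> (\<Sum>\<^sub>\<infinity>k. cmod (c k))" for x
    by (rule norm_infsum_le[OF fourier_series_has_sum has_sum_infsum[OF abs_summable]]) (simp add: norm_mult)
qed (rule periodic2_fourier_series)

text \<open>Uniform convergence carries the integral against \<open>character (- l)\<close> through
  the limit, and the coefficient of a partial sum is \<open>c l\<close> as soon as its index set
  contains \<open>l\<close>.\<close>

lemma fourier_coeff_fourier_series: "fourier_coeff (fourier_series c) l = c l"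
proof -
  define s where "s = (\<lambda>I x. \<Sum>k\<in>I. c k * character k x)"
  have "((\<lambda>I. LINT x:unit_square|lborel. character (- l) x * s I x)
      \<longlongrightarrow> (LINT x:unit_square|lborel. character (- l) x * fourier_series c x)) (finite_subsets_at_top UNIV)"
  proof (rule set_integral_mult_uniform_limit[OF set_integrable_character])
    show "set_integrable lborel unit_square (\<lambda>x. character (- l) x * s I x)" for I
    proof (cases "finite I")
      case True
      from set_integrable_mult_character[OF set_integrable_of_L2_torus[OF trig_sum_L2_torus[OF this, of c]]]
      show ?thesis by (simp add: s_def mult.commute)
    next
      \<comment> \<open>The family is indexed by arbitrary sets; over an infinite one the sum is 0
        by convention.\<close>
      case False
      then show ?thesis by (simp add: s_def set_integrable_def)
    qed
    show "set_integrable lborel unit_square (\<lambda>x. character (- l) x * fourier_series c x)"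
      using set_integrable_mult_character[OF set_integrable_of_L2_torus[OF fourier_series_L2_torus], of "- l"]
      by (simp add: mult.commute)
    show "uniform_limit unit_square s (fourier_series c) (finite_subsets_at_top UNIV)"
      unfolding s_def by (rule fourier_series_uniform_limit)
  qed
  then have "((\<lambda>I. fourier_coeff (s I) l) \<longlongrightarrow> fourier_coeff (fourier_series c) l) (finite_subsets_at_top UNIV)"
    by (simp add: fourier_coeff_character_form mult.commute)
  moreover have "\<forall>\<^sub>F I in finite_subsets_at_top UNIV. fourier_coeff (s I) l = c l"
  proof -
    have "\<forall>\<^sub>F I in finite_subsets_at_top UNIV. finite I \<and> l \<in> I"
      unfolding eventually_finite_subsets_at_top by (rule exI[of _ "{l}"]) auto
    then show ?thesis by eventually_elim (simp add: s_def fourier_coeff_trig_sum)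
  qed
  ultimately show ?thesis
    by (rule tendsto_unique[OF finite_subsets_at_top_neq_bot _ tendsto_eventually])
qed

end

section \<open>The continuous representative and its Fourier series\<close>

lemma continuous_AE_eq_imp_eq:
  fixes f g :: "'a::euclidean_space \<Rightarrow> 'b::{t2_space, second_countable_topology}"
  assumes "continuous_on UNIV f" "continuous_on UNIV g" "AE x in lborel. f x = g x"
  shows "f = g"
proof -
  \<comment> \<open>The set of disagreement is open, and a nonempty open set is not
    negligible.\<close>
  have op: "open {x. f x \<noteq> g x}" using assms(1,2) by (rule open_Collect_neq)
  have "{x. f x \<noteq> g x} \<in> null_sets lborel"
    using AE_iff_measurable[of "{x. f x \<noteq> g x}" lborel "\<lambda>x. f x = g x"] assms(3) op
    by (simp add: null_sets_def borel_open)
  then have "negligible {x. f x \<noteq> g x}"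
    by (simp add: negligible_iff_null_sets null_sets_completionI)
  with open_not_negligible[OF op] show ?thesis by auto
qed

text \<open>The series is continuous and periodic and has the coefficients of \<open>f\<close>, so
  it equals \<open>f\<close> almost everywhere. This is what expresses samples of \<open>f\<close>
  through its coefficients.\<close>

lemma continuous_rep_eq_fourier_series:
  assumes f: "f \<in> L2_torus" and sum: "(\<lambda>k. cmod (fourier_coeff f k)) summable_on UNIV"
  shows "continuous_rep f = fourier_series (fourier_coeff f)"
proof -
  let ?g = "fourier_series (fourier_coeff f)"
  note g = fourier_series_L2_torus[OF sum]
  have [measurable]: "f \<in> borel_measurable borel" "?g \<in> borel_measurable borel" and "periodic2 f"
    using f g by (auto simp: L2_torus_def)
  have d: "(\<lambda>x. ?g x - f x) \<in> L2_torus" by (rule L2_torus_diff[OF g f])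
  have "coeff_free (\<lambda>x. ?g x - f x)"
    using f g sum
    by (simp add: coeff_free_def fourier_coeff_diff set_integrable_of_L2_torus fourier_coeff_fourier_series
        set_integral_diff(1))
  then have "AE x in lborel. x \<in> unit_square \<longrightarrow> ?g x - f x = 0"
    by (intro coeff_free_AE_zero) simp_all
  then have "AE x in lborel. ?g x - f x = 0"
    using d by (intro AE_periodic_extension) (simp_all add: L2_torus_def)
  then have ae: "AE x in lborel. ?g x = f x" by simp
  show ?thesis
    unfolding continuous_rep_def
  proof (rule the_equality)
    show "continuous_on UNIV ?g \<and> periodic2 ?g \<and> (AE x in lborel. ?g x = f x)"
      using continuous_on_fourier_series[OF sum] periodic2_fourier_series[OF sum] ae by blast
    fix g' assume g': "continuous_on UNIV g' \<and> periodic2 g' \<and> (AE x in lborel. g' x = f x)"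
    then have "AE x in lborel. g' x = f x" by blast
    with ae have "AE x in lborel. g' x = ?g x" by eventually_elim simp
    with g' continuous_on_fourier_series[OF sum] show "g' = ?g"
      by (intro continuous_AE_eq_imp_eq) auto
  qed
qed

section \<open>Aliasing on a rank-1 lattice\<close>

definition freq_dot :: "int \<times> int \<Rightarrow> int \<times> int \<Rightarrow> int" where
  "freq_dot k z = fst k * fst z + snd k * snd z"

lemma freq_dot_diff: "freq_dot (k - l) z = freq_dot k z - freq_dot l z"
  by (simp add: freq_dot_def algebra_simps)

lemma character_lattice_node: "character k (lattice_node z M j) = cis (2 * pi * of_int (freq_dot k z) / of_nat M) ^ j"
  by (simp add: character_eq_cis pairing_def lattice_node_def freq_dot_def Complex.DeMoivre algebra_simps
      add_divide_distrib)

text \<open>Along the nodes a character runs through the powers of a number \<open>w\<close> with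
  \<open>w ^ M = 1\<close>; their geometric sum vanishes unless \<open>w = 1\<close>.\<close>

lemma sum_character_lattice:
  assumes "M > 0"
  shows "(\<Sum>j<M. character k (lattice_node z M j)) = (if int M dvd freq_dot k z then of_nat M else 0)"
proof -
  define w where "w = cis (2 * pi * of_int (freq_dot k z) / of_nat M)"
  have w1: "w = 1 \<longleftrightarrow> int M dvd freq_dot k z"
  proof
    assume "w = 1"
    then have "exp (\<i> * of_real (2 * pi * of_int (freq_dot k z) / of_nat M)) = exp 0"
      by (simp add: w_def cis_conv_exp)
    then obtain n :: int
      where "\<i> * of_real (2 * pi * of_int (freq_dot k z) / of_nat M) = 0 + (of_int (2 * n) * pi) * \<i>"
      unfolding exp_eq by blast
    from arg_cong[OF this, of Im] have "2 * pi * of_int (freq_dot k z) / of_nat M = 2 * of_int n * pi" by simp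
    then have "real_of_int (freq_dot k z) = real_of_int (n * int M)" using assms by (simp add: field_simps)
    then have "freq_dot k z = n * int M" by linarith
    then show "int M dvd freq_dot k z" by simp
  next
    assume "int M dvd freq_dot k z"
    then obtain n where "freq_dot k z = int M * n" by blast
    then show "w = 1"
      using assms cis_multiple_2pi[of "of_int n"] by (simp add: w_def mult.assoc)
  qed
  have "w ^ M = cis (2 * pi * of_int (freq_dot k z))"
    using assms by (simp add: w_def Complex.DeMoivre)
  then have "w ^ M = 1" by (simp add: cis_multiple_2pi)
  then have "(\<Sum>j<M. w ^ j) = (if w = 1 then of_nat M else 0)"
    by (simp add: sum_gp_strict)
  then show ?thesis by (simp add: character_lattice_node w1 flip: w_def)
qed

lemma has_sum_sum:
  fixes f :: "'j \<Rightarrow> 'a \<Rightarrow> 'b::topological_comm_monoid_add"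
  assumes "\<And>j. j \<in> J \<Longrightarrow> (f j has_sum s j) A"
  shows "((\<lambda>x. \<Sum>j\<in>J. f j x) has_sum (\<Sum>j\<in>J. s j)) A"
  using assms by (induction J rule: infinite_finite_induct) (auto intro: has_sum_add)

lemma lattice_coeff_character_form:
  "lattice_coeff z M f k =
    1 / of_nat M * (\<Sum>j<M. f (lattice_node z M j) * character (- k) (lattice_node z M j))"
  by (simp only: lattice_coeff_def character_minus)

text \<open>Averaging over the nodes annihilates every character except those whose frequency
  \<open>l\<close> is congruent to \<open>k\<close>. This is the aliasing formula.\<close>

lemma lattice_coeff_has_sum:
  assumes "M > 0" and c: "(\<lambda>k. cmod (c k)) summable_on UNIV"
  shows "((\<lambda>l. if freq_dot l z mod int M = freq_dot k z mod int M then c l else 0)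
    has_sum lattice_coeff z M (fourier_series c) k) UNIV"
proof -
  let ?x = "lattice_node z M"
  have "((\<lambda>l. 1 / of_nat M * (\<Sum>j<M. c l * character l (?x j) * character (- k) (?x j)))
      has_sum lattice_coeff z M (fourier_series c) k) UNIV"
    unfolding lattice_coeff_character_form
    by (intro has_sum_cmult_right has_sum_sum has_sum_cmult_left fourier_series_has_sum[OF c])
  moreover have "1 / of_nat M * (\<Sum>j<M. c l * character l (?x j) * character (- k) (?x j)) =
      (if freq_dot l z mod int M = freq_dot k z mod int M then c l else 0)" for l
  proof -
    have "(\<Sum>j<M. c l * character l (?x j) * character (- k) (?x j)) = c l * (\<Sum>j<M. character (l - k) (?x j))"
      unfolding sum_distrib_left by (intro sum.cong refl) (simp add: mult.assoc flip: character_add)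
    then show ?thesis
      using assms(1) by (simp add: sum_character_lattice mod_eq_dvd_iff freq_dot_diff)
  qed
  ultimately show ?thesis by simp
qed

text \<open>Congruent frequencies give characters that agree at all nodes, so sampling has the same
  output on both. Reconstruction returns each one unchanged; hence they coincide, and orthogonality
  identifies their frequencies.\<close>

lemma reconstructing_imp_inj:
  assumes "finite I" "reconstructing I z M" "k \<in> I" "l \<in> I"
    and cong: "freq_dot k z mod int M = freq_dot l z mod int M" and "M > 0"
  shows "k = l"
proof -
  have rec: "sampling_op I z M (character k) = character k" if "k \<in> I" for k
  proof -
    have "character k = (\<lambda>x. \<Sum>l\<in>I. (if l = k then 1 else 0) * character l x)"
      using that assms(1) by (simp add: if_distrib[of "\<lambda>a. a * _"] cong: if_cong)
    then have "character k \<in> trig_polys I"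
      unfolding trig_polys_def mem_Collect_eq by (rule exI[of _ "\<lambda>l. if l = k then 1 else 0"])
    then show ?thesis using assms(2) by (simp add: reconstructing_def)
  qed
  have "character k (lattice_node z M j) = character l (lattice_node z M j)" for j
  proof -
    obtain n where "freq_dot k z - freq_dot l z = int M * n"
      using cong unfolding mod_eq_dvd_iff by blast
    then have "freq_dot k z = freq_dot l z + int M * n" by simp
    then have "2 * pi * of_int (freq_dot k z) / of_nat M = 2 * pi * of_int (freq_dot l z) / of_nat M + 2 * pi * of_int n"
      using \<open>M > 0\<close> by (simp add: field_simps)
    then show ?thesis
      by (simp add: character_lattice_node cis_multiple_2pi flip: cis_mult)
  qed
  then have "sampling_op I z M (character k) = sampling_op I z M (character l)"
    by (simp add: sampling_op_def lattice_coeff_def)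
  then have "character k = character l" using rec assms(3,4) by simp
  then have "fourier_coeff (character k) l = 1" by (simp add: fourier_coeff_character)
  then show ?thesis by (simp add: fourier_coeff_character split: if_splits)
qed

lemma fourier_coeff_error_op:
  assumes "finite I" "f \<in> L2_torus"
  shows "fourier_coeff (error_op I z M f) k =
    fourier_coeff f k - (if k \<in> I then lattice_coeff z M (continuous_rep f) k else 0)"
  using assms unfolding error_op_def sampling_op_def
  by (simp add: fourier_coeff_diff trig_sum_L2_torus set_integrable_of_L2_torus fourier_coeff_trig_sum)

lemma error_op_L2_torus: "finite I \<Longrightarrow> f \<in> L2_torus \<Longrightarrow> error_op I z M f \<in> L2_torus"
  unfolding error_op_def sampling_op_def by (intro L2_torus_diff trig_sum_L2_torus)

section \<open>Weights and cosets of the dual lattice\<close>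

text \<open>Cauchy-Schwarz for \<open>cmod (c k) * sqrt (w k)\<close> and
  \<open>1 / sqrt (w k)\<close> bounds all finite sums by one constant. This serves both absolute
  convergence over all frequencies and the estimate over a single coset.\<close>

lemma infsum_Cauchy_Schwarz:
  fixes c :: "'a \<Rightarrow> complex"
  assumes w: "\<And>k. w k > 0"
    and X: "(\<lambda>k. (cmod (c k))\<^sup>2 * w k) summable_on D" and Y: "(\<lambda>k. 1 / w k) summable_on D"
  shows "(\<lambda>k. cmod (c k)) summable_on D"
    and "(cmod (infsum c D))\<^sup>2 \<le> (\<Sum>\<^sub>\<infinity>k\<in>D. 1 / w k) * (\<Sum>\<^sub>\<infinity>k\<in>D. (cmod (c k))\<^sup>2 * w k)"
proof -
  let ?X = "\<Sum>\<^sub>\<infinity>k\<in>D. (cmod (c k))\<^sup>2 * w k" and ?Y = "\<Sum>\<^sub>\<infinity>k\<in>D. 1 / w k"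
  have w': "0 \<le> w k" "w k \<noteq> 0" for k using w[of k] by simp_all
  have X0: "?X \<ge> 0" and Y0: "?Y \<ge> 0" by (auto intro!: infsum_nonneg simp: w')
  have fin: "(\<Sum>k\<in>F. cmod (c k)) \<le> sqrt (?Y * ?X)" if F: "finite F" "F \<subseteq> D" for F
  proof -
    have "(\<Sum>k\<in>F. cmod (c k)) = (\<Sum>k\<in>F. (cmod (c k) * sqrt (w k)) * (1 / sqrt (w k)))"
      by (intro sum.cong refl) (simp add: w')
    then have "(\<Sum>k\<in>F. cmod (c k))\<^sup>2 \<le> (\<Sum>k\<in>F. (cmod (c k) * sqrt (w k))\<^sup>2) * (\<Sum>k\<in>F. (1 / sqrt (w k))\<^sup>2)"
      by (simp only: Cauchy_Schwarz_ineq_sum)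
    also have "\<dots> = (\<Sum>k\<in>F. (cmod (c k))\<^sup>2 * w k) * (\<Sum>k\<in>F. 1 / w k)"
      by (simp add: power_mult_distrib power_divide w')
    also have "\<dots> \<le> ?X * ?Y"
      using F X Y by (intro mult_mono finite_sum_le_infsum X0 sum_nonneg) (auto simp: w')
    finally show ?thesis by (intro real_le_rsqrt) (simp add: mult.commute)
  qed
  show abs: "(\<lambda>k. cmod (c k)) summable_on D"
    by (rule nonneg_bdd_above_summable_on) (auto intro!: bdd_aboveI[of _ "sqrt (?Y * ?X)"] fin)
  have "cmod (infsum c D) \<le> (\<Sum>\<^sub>\<infinity>k\<in>D. cmod (c k))" by (rule norm_infsum_bound[OF abs])
  also have "\<dots> \<le> sqrt (?Y * ?X)" by (rule infsum_le_finite_sums[OF abs fin])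
  finally have "(cmod (infsum c D))\<^sup>2 \<le> (sqrt (?Y * ?X))\<^sup>2" by (intro power_mono) auto
  then show "(cmod (infsum c D))\<^sup>2 \<le> ?Y * ?X" using X0 Y0 by simp
qed

section \<open>The mixed and the isotropic weight\<close>

definition mix_weight :: "int \<times> int \<Rightarrow> real" where
  "mix_weight k = (1 + (of_int (fst k))\<^sup>2) * (1 + (of_int (snd k))\<^sup>2)"

definition iso_weight :: "int \<times> int \<Rightarrow> real" where
  "iso_weight k = 1 + ((of_int (fst k))\<^sup>2 + (of_int (snd k))\<^sup>2)"

lemma iso_weight_ge_1: "iso_weight k \<ge> 1"
  by (simp add: iso_weight_def)

lemma iso_weight_le_mix_weight: "iso_weight k \<le> mix_weight k"
  by (simp add: iso_weight_def mix_weight_def algebra_simps)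

lemma mix_weight_pos: "mix_weight k > 0"
  using iso_weight_le_mix_weight[of k] iso_weight_ge_1[of k] by linarith

lemma Hmix_norm_eq: "Hmix_norm \<alpha> = weighted_norm (\<lambda>k. mix_weight k powr \<alpha>)"
  by (simp add: Hmix_norm_def mix_weight_def case_prod_unfold powr_mult)

lemma H_norm_eq: "H_norm \<gamma> = weighted_norm (\<lambda>k. iso_weight k powr \<gamma>)"
  by (simp add: H_norm_def iso_weight_def case_prod_unfold)

lemma summable_on_int_weight:
  fixes \<alpha> :: real
  assumes "\<alpha> > 1 / 2"
  shows "(\<lambda>m::int. (1 + (of_int m)\<^sup>2) powr (- \<alpha>)) summable_on UNIV"
proof -
  let ?v = "\<lambda>m::int. (1 + (real_of_int m)\<^sup>2) powr (- \<alpha>)"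
  have "summable (\<lambda>n. real n powr (- 2 * \<alpha>))"
    using assms by (simp add: summable_real_powr_iff)
  then have "summable (\<lambda>n. (1 + (real n)\<^sup>2) powr (- \<alpha>))"
  \<comment> \<open>The comparison starts at 1 because \<open>0 powr (- 2 * \<alpha>)\<close> is 0,
    below the term 1 at \<open>n = 0\<close>.\<close>
  proof (rule summable_comparison_test'[where N=1])
    fix n :: nat assume "n \<ge> 1"
    have "(1 + (real n)\<^sup>2) powr (- \<alpha>) \<le> ((real n)\<^sup>2) powr (- \<alpha>)"
      using \<open>n \<ge> 1\<close> assms by (intro powr_mono2') auto
    also have "\<dots> = real n powr (- 2 * \<alpha>)"
      using \<open>n \<ge> 1\<close> by (simp add: powr_powr flip: powr_numeral)
    finally show "norm ((1 + (real n)\<^sup>2) powr (- \<alpha>)) \<le> real n powr (- 2 * \<alpha>)" by simp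
  qed
  then have nat: "(\<lambda>n. (1 + (real n)\<^sup>2) powr (- \<alpha>)) summable_on UNIV"
    by (subst summable_on_UNIV_nonneg_real_iff) auto
  \<comment> \<open>The integers are covered by two copies of the naturals; their overlap at 0 is
    harmless for summability.\<close>
  have "?v summable_on range int"
    using nat by (subst summable_on_reindex) (auto simp: o_def)
  moreover have "?v summable_on range (\<lambda>n. - int n)"
    using nat by (subst summable_on_reindex) (auto simp: o_def inj_on_def)
  ultimately have "?v summable_on (range int \<union> range (\<lambda>n. - int n))"
    by (rule summable_on_union)
  moreover have "range int \<union> range (\<lambda>n. - int n) = UNIV"
    by (auto simp: image_iff) (metis int_cases2)
  ultimately show ?thesis by simp
qed

text \<open>The weight is a product over the coordinates, so each inner sum is a multiple of the
  one-dimensional weight.\<close>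

lemma summable_on_mix_weight:
  assumes "\<alpha> > 1 / 2"
  shows "(\<lambda>k. mix_weight k powr (- \<alpha>)) summable_on UNIV"
proof -
  let ?v = "\<lambda>m::int. (1 + (real_of_int m)\<^sup>2) powr (- \<alpha>)"
  note v = summable_on_int_weight[OF assms]
  have "(\<lambda>k. mix_weight k powr (- \<alpha>)) summable_on (SIGMA a:UNIV. UNIV)"
  proof (rule summable_on_SigmaI)
    show "((\<lambda>b. mix_weight (a, b) powr (- \<alpha>)) has_sum ?v a * infsum ?v UNIV) UNIV" for a
      using has_sum_cmult_right[OF has_sum_infsum[OF v], of "?v a"] by (simp add: mix_weight_def powr_mult)
    show "(\<lambda>a. ?v a * infsum ?v UNIV) summable_on UNIV"
      using v by (rule summable_on_cmult_left)
  qed simp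
  then show ?thesis by simp
qed

section \<open>The frequency box and the tiling of the integer plane by its translates\<close>

definition freq_box :: "nat \<Rightarrow> (int \<times> int) set" where
  "freq_box n = {k. - (2 ^ n) < 2 * fst k \<and> 2 * fst k \<le> 2 ^ n \<and>
    - (2 ^ n) < 2 * snd k \<and> 2 * snd k \<le> 2 ^ n}"

text \<open>Doubling the inequalities clears the half side
  \<open>2 powi (\<lfloor>R\<rfloor> - 1)\<close>, which is 1/2 for \<open>R < 1\<close>; the box
  can then be treated within the integers.\<close>

lemma G_eq_freq_box:
  assumes "R \<ge> 0"
  shows "G R = freq_box (nat \<lfloor>R\<rfloor>)"
proof -
  define n where "n = nat \<lfloor>R\<rfloor>"
  have "\<lfloor>R\<rfloor> = int n" using assms by (simp add: n_def)
  then have p: "(2::real) powi (\<lfloor>R\<rfloor> - 1) = 2 ^ n / 2" by (simp add: power_int_diff)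
  have le: "of_int a \<le> (2::real) ^ n / 2 \<longleftrightarrow> 2 * a \<le> 2 ^ n" for a :: int
  proof -
    have "of_int a \<le> (2::real) ^ n / 2 \<longleftrightarrow> real_of_int (2 * a) \<le> real_of_int (2 ^ n)" by auto
    then show ?thesis by (simp only: of_int_le_iff)
  qed
  have less: "- ((2::real) ^ n / 2) < of_int a \<longleftrightarrow> - (2 ^ n) < 2 * a" for a :: int
  proof -
    have "- ((2::real) ^ n / 2) < of_int a \<longleftrightarrow> real_of_int (- (2 ^ n)) < real_of_int (2 * a)" by auto
    then show ?thesis by (simp only: of_int_less_iff)
  qed
  show ?thesis
    unfolding G_def freq_box_def p greaterThanAtMost_iff le less n_def [symmetric] by auto
qed

lemma finite_freq_box: "finite (freq_box n)"
proof (rule finite_subset)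
  show "freq_box n \<subseteq> {- (2 ^ n)..2 ^ n} \<times> {- (2 ^ n)..2 ^ n}"
    by (auto simp: freq_box_def)
qed simp

text \<open>The \<open>a\<close> with \<open>m\<close> in the half-open interval of length \<open>2 ^ n\<close> centred at \<open>2 ^ n * a\<close>.\<close>

definition cell1 :: "nat \<Rightarrow> int \<Rightarrow> int" where
  "cell1 n m = - ((2 ^ n - 2 * m) div (2 * 2 ^ n))"

definition cell :: "nat \<Rightarrow> int \<times> int \<Rightarrow> int \<times> int" where
  "cell n k = (cell1 n (fst k), cell1 n (snd k))"

lemma cell1_bounds:
  "- (2 ^ n) < 2 * (m - 2 ^ n * cell1 n m) \<and> 2 * (m - 2 ^ n * cell1 n m) \<le> 2 ^ n"
proof -
  define q :: int where "q = 2 ^ n - 2 * m"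
  \<comment> \<open>The remainder of \<open>q\<close> lies in \<open>{0..<2 * 2 ^ n}\<close>: its
    value 0 gives the closed upper end of the cell, its excluded bound the open lower end.\<close>
  have "2 * 2 ^ n * (q div (2 * 2 ^ n)) + q mod (2 * 2 ^ n) = q" by (rule mult_div_mod_eq)
  then have "2 * (m - 2 ^ n * cell1 n m) = 2 ^ n - q mod (2 * 2 ^ n)"
    unfolding cell1_def q_def[symmetric] by (simp add: q_def algebra_simps)
  moreover have "0 \<le> q mod (2 * 2 ^ n)" "q mod (2 * 2 ^ n) < 2 * 2 ^ n"
    by simp_all
  ultimately show ?thesis by linarith
qed

lemma cell_freq_box: "k \<in> freq_box n \<Longrightarrow> cell n k = 0"
  by (simp add: freq_box_def cell_def cell1_def zero_prod_def)

lemma diff_cell_in_freq_box: "k - (2 ^ n * fst (cell n k), 2 ^ n * snd (cell n k)) \<in> freq_box n"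
  using cell1_bounds[of n "fst k"] cell1_bounds[of n "snd k"] by (simp add: freq_box_def cell_def)

lemma four_power: "(4::int) ^ n = (2 ^ n)\<^sup>2"
  by (simp add: power2_eq_square flip: power_mult_distrib)

text \<open>A point \<open>m\<close> of a cell \<open>c \<noteq> 0\<close> is within
  \<open>2 ^ n / 2\<close> of \<open>2 ^ n * c\<close>, so
  \<open>2 ^ n * \<bar>c\<bar> \<le> 2 * \<bar>m\<bar>\<close>. Squaring costs a factor 4 and
  bounding \<open>1 + c\<^sup>2\<close> by \<open>2 * c\<^sup>2\<close> another 2, whence the
  8.\<close>

lemma cell1_weight:
  defines "a \<equiv> \<lambda>n m. real_of_int (cell1 n m)"
  shows "(1 + (a n m)\<^sup>2) * (if cell1 n m = 0 then 1 else 4 ^ n / 8) \<le> 1 + (of_int m)\<^sup>2"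
proof (cases "cell1 n m = 0")
  case False
  define c where "c = cell1 n m"
  have c: "\<bar>c\<bar> \<ge> 1" using False by (simp add: c_def)
  have "2 * \<bar>m\<bar> \<ge> 2 * (2 ^ n * \<bar>c\<bar>) - 2 ^ n"
    using cell1_bounds[of n m, folded c_def] by (simp add: abs_mult algebra_simps abs_if split: if_splits)
  moreover have "2 ^ n \<le> 2 ^ n * \<bar>c\<bar>" using c by simp
  ultimately have "2 ^ n * \<bar>c\<bar> \<le> 2 * \<bar>m\<bar>" by linarith
  then have "(2 ^ n * \<bar>c\<bar>)\<^sup>2 \<le> (2 * \<bar>m\<bar>)\<^sup>2" by (intro power_mono) auto
  then have "4 ^ n * c\<^sup>2 \<le> 4 * m\<^sup>2" by (simp add: power_mult_distrib four_power)
  then have "real_of_int (4 ^ n * c\<^sup>2) \<le> real_of_int (4 * m\<^sup>2)" by (simp only: of_int_le_iff)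
  then have 1: "4 ^ n * (real_of_int c)\<^sup>2 \<le> 4 * (real_of_int m)\<^sup>2" by simp
  have "1 \<le> c\<^sup>2" using c by (simp add: abs_square_le_1 flip: abs_le_square_iff[of 1 c, simplified])
  then have "1 \<le> (real_of_int c)\<^sup>2" by (metis of_int_1_le_iff of_int_power)
  then have "4 ^ n * (1 + (real_of_int c)\<^sup>2) \<le> 4 ^ n * (2 * (real_of_int c)\<^sup>2)" by (intro mult_left_mono) auto
  with 1 have "4 ^ n * (1 + (real_of_int c)\<^sup>2) \<le> 8 * (real_of_int m)\<^sup>2" by linarith
  with False show ?thesis by (simp add: a_def c_def field_simps)
qed (simp add: a_def)

text \<open>At least one coordinate lies outside the central cell and contributes
  \<open>4 ^ n / 8\<close>. The other contributes 1 or again \<open>4 ^ n / 8\<close>, which is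
  below 1 for small \<open>n\<close>; the constant 64 covers both cases.\<close>

lemma cell_weight:
  assumes "cell n k \<noteq> 0"
  shows "mix_weight (cell n k) * (4 ^ n / 64) \<le> mix_weight k"
proof -
  define r where "r = (\<lambda>m. if cell1 n m = 0 then 1 else (4::real) ^ n / 8)"
  have "4 ^ n / 64 \<le> r (fst k) * r (snd k)"
  proof -
    have one: "(1::real) \<le> 4 ^ n" by simp
    have two: "(4::real) ^ n \<le> 4 ^ n * 4 ^ n" using one by simp
    from assms have "cell1 n (fst k) \<noteq> 0 \<or> cell1 n (snd k) \<noteq> 0" by (auto simp: cell_def zero_prod_def)
    with two show ?thesis by (auto simp: r_def)
  qed
  then have "mix_weight (cell n k) * (4 ^ n / 64) \<le> mix_weight (cell n k) * (r (fst k) * r (snd k))"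
    using mix_weight_pos[of "cell n k"] by (intro mult_left_mono) auto
  also have "\<dots> = ((1 + (of_int (cell1 n (fst k)))\<^sup>2) * r (fst k)) * ((1 + (of_int (cell1 n (snd k)))\<^sup>2) * r (snd k))"
    by (simp add: mix_weight_def cell_def)
  also have "\<dots> \<le> mix_weight k"
    unfolding mix_weight_def r_def by (intro mult_mono cell1_weight) auto
  finally show ?thesis .
qed

section \<open>Cosets of the dual lattice against the tiling\<close>

definition coset :: "int \<times> int \<Rightarrow> nat \<Rightarrow> int \<times> int \<Rightarrow> (int \<times> int) set" where
  "coset z M k = {l. freq_dot l z mod int M = freq_dot k z mod int M}"

text \<open>Two points of a coset in one tile are carried into the box by the same translation and
  stay congruent, so \<open>inj\<close> identifies them.\<close>

lemma inj_on_cell_coset: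
  assumes inj: "\<And>k l. k \<in> freq_box n \<Longrightarrow> l \<in> freq_box n \<Longrightarrow>
      freq_dot k z mod int M = freq_dot l z mod int M \<Longrightarrow> k = l"
  shows "inj_on (cell n) (coset z M k)"
proof (rule inj_onI)
  fix l l' assume l: "l \<in> coset z M k" "l' \<in> coset z M k" and eq: "cell n l = cell n l'"
  define t where "t = (2 ^ n * fst (cell n l), 2 ^ n * snd (cell n l))"
  have "l - t \<in> freq_box n" "l' - t \<in> freq_box n"
    using diff_cell_in_freq_box[of l n] diff_cell_in_freq_box[of l' n] by (simp_all add: t_def eq)
  moreover have "freq_dot (l - t) z mod int M = freq_dot (l' - t) z mod int M"
    using l unfolding freq_dot_diff coset_def by (auto intro: mod_diff_cong)
  ultimately have "l - t = l' - t" by (rule inj)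
  then show "l = l'" by simp
qed

text \<open>The central tile is taken by \<open>k\<close>, so every other point of the coset lies in
  a nonzero tile and gains the factor \<open>4 ^ n / 64\<close>. Each tile is hit at most once, so
  the sum over the tiles hit is at most the sum over all of them.\<close>

lemma coset_weight_sum:
  assumes "\<alpha> > 1 / 2" and k: "k \<in> freq_box n"
    and inj: "\<And>k l. k \<in> freq_box n \<Longrightarrow> l \<in> freq_box n \<Longrightarrow>
      freq_dot k z mod int M = freq_dot l z mod int M \<Longrightarrow> k = l"
  shows "(\<Sum>\<^sub>\<infinity>l\<in>coset z M k - {k}. mix_weight l powr (- \<alpha>))
    \<le> (4 ^ n / 64) powr (- \<alpha>) * (\<Sum>\<^sub>\<infinity>l. mix_weight l powr (- \<alpha>))"
proof -
  let ?u = "\<lambda>l. mix_weight l powr (- \<alpha>)" and ?D = "coset z M k - {k}"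
  note sum = summable_on_mix_weight[OF assms(1)]
  have ij: "inj_on (cell n) (coset z M k)" using inj by (rule inj_on_cell_coset)
  then have ic: "inj_on (cell n) ?D" by (rule inj_on_subset) auto
  have le: "?u l \<le> (4 ^ n / 64) powr (- \<alpha>) * ?u (cell n l)" if "l \<in> ?D" for l
  proof -
    have "k \<in> coset z M k" by (simp add: coset_def)
    then have "cell n l \<noteq> 0"
      using inj_onD[OF ij, of l k] cell_freq_box[OF k] that by auto
    then have "mix_weight l powr (- \<alpha>) \<le> (mix_weight (cell n l) * (4 ^ n / 64)) powr (- \<alpha>)"
      using assms(1) mix_weight_pos[of "cell n l"] by (intro powr_mono2' cell_weight) auto
    also have "\<dots> = (4 ^ n / 64) powr (- \<alpha>) * ?u (cell n l)"
      using mix_weight_pos[of "cell n l"] by (subst powr_mult) (auto simp: mult.commute less_imp_le)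
    finally show ?thesis .
  qed
  have si: "?u summable_on (cell n ` ?D)" by (rule summable_on_subset[OF sum]) simp
  then have sc: "(\<lambda>l. ?u (cell n l)) summable_on ?D"
    by (simp add: summable_on_reindex[OF ic] o_def)
  have "(\<Sum>\<^sub>\<infinity>l\<in>?D. ?u l) \<le> (\<Sum>\<^sub>\<infinity>l\<in>?D. (4 ^ n / 64) powr (- \<alpha>) * ?u (cell n l))"
    by (intro infsum_mono le summable_on_cmult_right sc) (rule summable_on_subset[OF sum], simp)
  also have "\<dots> = (4 ^ n / 64) powr (- \<alpha>) * (\<Sum>\<^sub>\<infinity>l\<in>?D. ?u (cell n l))"
    by (rule infsum_cmult_right) (rule sc)
  also have "(\<Sum>\<^sub>\<infinity>l\<in>?D. ?u (cell n l)) = infsum ?u (cell n ` ?D)"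
    by (simp add: infsum_reindex[OF ic] o_def)
  also have "(4 ^ n / 64) powr (- \<alpha>) * infsum ?u (cell n ` ?D) \<le> (4 ^ n / 64) powr (- \<alpha>) * infsum ?u UNIV"
    by (intro mult_left_mono infsum_mono2 si sum) auto
  finally show ?thesis .
qed

text \<open>Split off \<open>iso_weight k powr (- (\<alpha> - \<gamma>))\<close>: it is small
  because some coordinate has absolute value at least \<open>2 ^ n / 2\<close>. The remaining
  \<open>iso_weight k powr \<alpha>\<close> is dominated by the mixed weight.\<close>

lemma iso_weight_outside_freq_box:
  assumes "k \<notin> freq_box n" "0 \<le> \<gamma>" "\<gamma> < \<alpha>"
  shows "iso_weight k powr \<gamma> \<le> (4 ^ n / 4) powr (- (\<alpha> - \<gamma>)) * mix_weight k powr \<alpha>"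
proof -
  have sq: "4 ^ n \<le> 4 * m\<^sup>2" if "\<not> (- (2 ^ n) < 2 * m \<and> 2 * m \<le> 2 ^ n)" for m :: int
  proof -
    have "2 ^ n \<le> \<bar>2 * m\<bar>" using that by linarith
    then have "(2 ^ n)\<^sup>2 \<le> \<bar>2 * m\<bar>\<^sup>2" by (intro power_mono) auto
    then show ?thesis by (simp add: power_mult_distrib four_power)
  qed
  have "4 ^ n \<le> 4 * ((fst k)\<^sup>2 + (snd k)\<^sup>2)"
    using assms(1) sq[of "fst k"] sq[of "snd k"] zero_le_power2[of "fst k"] zero_le_power2[of "snd k"]
    unfolding freq_box_def by (smt (verit) mem_Collect_eq)
  then have "real_of_int (4 ^ n) \<le> real_of_int (4 * ((fst k)\<^sup>2 + (snd k)\<^sup>2))" by (simp only: of_int_le_iff)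
  then have "4 ^ n / 4 \<le> iso_weight k" by (simp add: iso_weight_def)
  then have "iso_weight k powr (- (\<alpha> - \<gamma>)) \<le> (4 ^ n / 4) powr (- (\<alpha> - \<gamma>))"
    using assms by (intro powr_mono2') auto
  moreover have "iso_weight k powr \<alpha> \<le> mix_weight k powr \<alpha>"
    using assms iso_weight_ge_1[of k] by (intro powr_mono2 iso_weight_le_mix_weight) auto
  ultimately have "iso_weight k powr (- (\<alpha> - \<gamma>)) * iso_weight k powr \<alpha>
      \<le> (4 ^ n / 4) powr (- (\<alpha> - \<gamma>)) * mix_weight k powr \<alpha>"
    by (intro mult_mono) auto
  then show ?thesis by (simp flip: powr_add)
qed

text \<open>Coordinates of absolute value at most \<open>2 ^ n / 2\<close> have squares summing to
  at most \<open>4 ^ n / 2\<close>, and \<open>1 \<le> 4 ^ n\<close> absorbs the 1. This limits the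
  growth of the target weight on aliasing errors.\<close>

lemma iso_weight_freq_box:
  assumes "k \<in> freq_box n"
  shows "iso_weight k \<le> 2 * 4 ^ n"
proof -
  have sq: "4 * m\<^sup>2 \<le> 4 ^ n" if "- (2 ^ n) < 2 * m \<and> 2 * m \<le> 2 ^ n" for m :: int
  proof -
    have "\<bar>2 * m\<bar> \<le> 2 ^ n" using that by linarith
    then have "\<bar>2 * m\<bar>\<^sup>2 \<le> (2 ^ n)\<^sup>2" by (intro power_mono) auto
    then show ?thesis by (simp add: power_mult_distrib four_power)
  qed
  have "4 * ((fst k)\<^sup>2 + (snd k)\<^sup>2) \<le> 2 * 4 ^ n"
    using assms sq[of "fst k"] sq[of "snd k"] by (simp add: freq_box_def)
  then have "real_of_int (4 * ((fst k)\<^sup>2 + (snd k)\<^sup>2)) \<le> real_of_int (2 * 4 ^ n)" by (simp only: of_int_le_iff)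
  then have le: "4 * ((real_of_int (fst k))\<^sup>2 + (real_of_int (snd k))\<^sup>2) \<le> 2 * 4 ^ n" by simp
  have "1 + s \<le> 2 * x" if "4 * s \<le> 2 * x" "1 \<le> x" for s x :: real
    using that by linarith
  from this[OF le] show ?thesis by (simp add: iso_weight_def)
qed

section \<open>Bounds for the error operator\<close>

lemma weighted_norm_le_1D:
  assumes "weighted_norm w f \<le> 1" and "\<And>k. 0 \<le> w k"
  shows "f \<in> L2_torus" "(\<lambda>k. (cmod (fourier_coeff f k))\<^sup>2 * w k) summable_on UNIV"
    "(\<Sum>\<^sub>\<infinity>k. (cmod (fourier_coeff f k))\<^sup>2 * w k) \<le> 1"
proof -
  have *: "f \<in> L2_torus \<and> (\<lambda>k. (cmod (fourier_coeff f k))\<^sup>2 * w k) summable_on UNIV"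
    using assms(1) by (auto simp: weighted_norm_def top_unique split: if_splits)
  then show "f \<in> L2_torus" "(\<lambda>k. (cmod (fourier_coeff f k))\<^sup>2 * w k) summable_on UNIV" by auto
  show "(\<Sum>\<^sub>\<infinity>k. (cmod (fourier_coeff f k))\<^sup>2 * w k) \<le> 1"
    using assms(1) * by (simp add: weighted_norm_def)
qed

text \<open>The summands account for the frequencies outside and inside the box.\<close>

definition error_const :: "real \<Rightarrow> real \<Rightarrow> real" where
  "error_const \<alpha> \<gamma> = 4 powr (\<alpha> - \<gamma>) + 64 powr \<alpha> * 2 powr \<gamma> * (\<Sum>\<^sub>\<infinity>l. mix_weight l powr (- \<alpha>))"

lemma error_const_pos: "error_const \<alpha> \<gamma> > 0"
proof -
  have "(\<Sum>\<^sub>\<infinity>l. mix_weight l powr (- \<alpha>)) \<ge> 0" by (intro infsum_nonneg) simp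
  then show ?thesis unfolding error_const_def by (intro add_pos_nonneg mult_nonneg_nonneg) auto
qed

text \<open>The lattice coefficient sums the coefficients of \<open>f\<close> over the whole coset;
  subtracting it cancels the term at \<open>k\<close> and leaves only aliasing.\<close>

lemma error_coeff_in_freq_box:
  assumes c: "(\<lambda>k. cmod (fourier_coeff f k)) summable_on UNIV" and f: "f \<in> L2_torus"
    and "M > 0" and k: "k \<in> freq_box n"
  shows "fourier_coeff (error_op (freq_box n) z M f) k = - infsum (fourier_coeff f) (coset z M k - {k})"
proof -
  let ?c = "fourier_coeff f"
  have "(?c has_sum lattice_coeff z M (fourier_series ?c) k) (coset z M k) \<longleftrightarrow>
      ((\<lambda>l. if freq_dot l z mod int M = freq_dot k z mod int M then ?c l else 0)
        has_sum lattice_coeff z M (fourier_series ?c) k) UNIV"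
    by (rule has_sum_cong_neutral) (auto simp: coset_def)
  with lattice_coeff_has_sum[OF \<open>M > 0\<close> c, of z k]
  have "(?c has_sum lattice_coeff z M (fourier_series ?c) k) (coset z M k)" by blast
  then have L: "lattice_coeff z M (fourier_series ?c) k = infsum ?c (coset z M k)"
    by (simp add: has_sum_iff)
  have "coset z M k = insert k (coset z M k - {k})" by (auto simp: coset_def)
  moreover have "?c summable_on (coset z M k - {k})"
    by (rule abs_summable_summable[OF summable_on_subset[OF c]]) simp
  ultimately have "infsum ?c (coset z M k) = ?c k + infsum ?c (coset z M k - {k})"
    by (metis Diff_iff infsum_insert insertI1)
  with k L show ?thesis
    by (simp add: fourier_coeff_error_op[OF finite_freq_box f] continuous_rep_eq_fourier_series[OF f c])
qed

text \<open>Cauchy-Schwarz on each coset controls the aliasing inside the box, and the comparison of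
  weights controls the truncation outside it. Each contributes at most \<open>B\<close> to the
  squared norm, whence the factor 2.\<close>

lemma H_norm_error_op_le:
  assumes \<alpha>: "\<alpha> > 1 / 2" and \<gamma>: "0 \<le> \<gamma>" "\<gamma> < \<alpha>" and M: "M > 0"
    and rec: "reconstructing (freq_box n) z M" and f: "Hmix_norm \<alpha> f \<le> 1"
  shows "H_norm \<gamma> (error_op (freq_box n) z M f)
    \<le> ennreal (sqrt (2 * error_const \<alpha> \<gamma> * (4 ^ n) powr (- (\<alpha> - \<gamma>))))"
proof -
  let ?c = "fourier_coeff f" and ?e = "fourier_coeff (error_op (freq_box n) z M f)"
  let ?s = "\<lambda>k. (cmod (?c k))\<^sup>2 * mix_weight k powr \<alpha>"
  let ?t = "\<lambda>k. (cmod (?e k))\<^sup>2 * iso_weight k powr \<gamma>"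
  define K where "K = (\<Sum>\<^sub>\<infinity>l. mix_weight l powr (- \<alpha>))"
  define B where "B = error_const \<alpha> \<gamma> * (4 ^ n) powr (- (\<alpha> - \<gamma>))"
  have w: "mix_weight k powr \<alpha> > 0" for k using mix_weight_pos[of k] by simp
  have K0: "K \<ge> 0" unfolding K_def by (intro infsum_nonneg) simp
  have "B > 0" unfolding B_def using error_const_pos by simp
  have fL2: "f \<in> L2_torus" and sumc: "?s summable_on UNIV" and le1: "infsum ?s UNIV \<le> 1"
    using weighted_norm_le_1D[OF f[unfolded Hmix_norm_eq]] by auto
  have s0: "?s k \<ge> 0" for k by simp
  have Y: "(\<lambda>k. 1 / mix_weight k powr \<alpha>) summable_on A" for A
    using summable_on_subset[OF summable_on_mix_weight[OF \<alpha>], of A] by (simp add: powr_minus_divide)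
  have sumcA: "?s summable_on A" for A by (rule summable_on_subset[OF sumc]) simp
  note cs = infsum_Cauchy_Schwarz[where w = "\<lambda>k. mix_weight k powr \<alpha>", OF w sumcA Y]
  have inj: "k = l" if "k \<in> freq_box n" "l \<in> freq_box n" "freq_dot k z mod int M = freq_dot l z mod int M" for k l
    using reconstructing_imp_inj[OF finite_freq_box rec that M] .
  let ?D = "\<lambda>k. coset z M k - {k}"
  have inside: "?t k \<le> B * infsum ?s (?D k)" if k: "k \<in> freq_box n" for k
  proof -
    have S0: "infsum ?s (?D k) \<ge> 0" by (intro infsum_nonneg) (rule s0)
    have "(cmod (?e k))\<^sup>2 \<le> (\<Sum>\<^sub>\<infinity>l\<in>?D k. 1 / mix_weight l powr \<alpha>) * infsum ?s (?D k)"
      using cs(2)[of "?D k"] by (simp add: error_coeff_in_freq_box[OF cs(1) fL2 M k])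
    also have "\<dots> \<le> ((4 ^ n / 64) powr (- \<alpha>) * K) * infsum ?s (?D k)"
      using coset_weight_sum[OF \<alpha> k inj] S0 unfolding K_def
      by (intro mult_right_mono) (simp_all add: powr_minus_divide)
    finally have "?t k \<le> ((4 ^ n / 64) powr (- \<alpha>) * K) * infsum ?s (?D k) * (2 * 4 ^ n) powr \<gamma>"
      using iso_weight_freq_box[OF k] iso_weight_ge_1[of k] \<gamma> S0 K0
      by (intro mult_mono powr_mono2) auto
    \<comment> \<open>The decay \<open>(4 ^ n) powr (- \<alpha>)\<close> over the coset and the
      growth \<open>(4 ^ n) powr \<gamma>\<close> of the weight combine to the same rate as outside
      the box.\<close>
    also have "\<dots> = (64 powr \<alpha> * 2 powr \<gamma> * K) * (4 ^ n) powr (- (\<alpha> - \<gamma>)) * infsum ?s (?D k)"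
    proof -
      have "(4 ^ n / 64) powr (- \<alpha>) * (2 * 4 ^ n) powr \<gamma> = 64 powr \<alpha> * 2 powr \<gamma> * (4 ^ n) powr (- (\<alpha> - \<gamma>))"
        by (simp add: powr_divide powr_mult powr_minus_divide powr_diff)
      moreover have "x * K * S * y = c * K * u * S" if "x * y = c * u" for x y c u S :: real
      proof -
        have "x * K * S * y = (x * y) * (K * S)" by (simp only: mult_ac)
        then show ?thesis by (simp only: that mult_ac)
      qed
      ultimately show ?thesis by blast
    qed
    also have "\<dots> \<le> B * infsum ?s (?D k)"
      using S0 unfolding B_def error_const_def K_def by (intro mult_right_mono) (auto simp: distrib_right)
    finally show ?thesis .
  qed
  have outside: "?t k \<le> B * ?s k" if k: "k \<notin> freq_box n" for k
  proof -
    have "?e k = ?c k" using k by (simp add: fourier_coeff_error_op[OF finite_freq_box fL2])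
    moreover have "iso_weight k powr \<gamma> \<le> B * mix_weight k powr \<alpha>"
    proof -
      have "(4 ^ n / 4) powr (- (\<alpha> - \<gamma>)) = 4 powr (\<alpha> - \<gamma>) * (4 ^ n) powr (- (\<alpha> - \<gamma>))"
        by (simp add: powr_divide powr_minus_divide powr_diff)
      also have "\<dots> \<le> B"
        using K0 unfolding B_def error_const_def K_def by (intro mult_right_mono) auto
      finally show ?thesis
        using iso_weight_outside_freq_box[OF k \<gamma>] w[of k] by (meson less_imp_le mult_right_mono order_trans)
    qed
    ultimately have "?t k \<le> (cmod (?c k))\<^sup>2 * (B * mix_weight k powr \<alpha>)"
      by (simp add: mult_left_mono)
    then show ?thesis by (simp add: mult_ac)
  qed
  \<comment> \<open>A bound on all finite sums yields at once that the error lies in the target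
    space and that its norm is small.\<close>
  have finite_sums: "sum ?t F \<le> 2 * B" if F: "finite F" for F
  proof -
    have "sum ?t (F \<inter> freq_box n) \<le> (\<Sum>k\<in>F \<inter> freq_box n. B * infsum ?s (?D k))"
      by (intro sum_mono inside) auto
    also have "\<dots> = B * infsum ?s (\<Union>k\<in>F \<inter> freq_box n. ?D k)"
    proof -
      \<comment> \<open>By \<open>inj\<close>, distinct box points have disjoint cosets, so the
        coset sums merge into one sum, itself part of a total of at most 1.\<close>
      have "(\<Sum>k\<in>F \<inter> freq_box n. infsum ?s (?D k)) = infsum ?s (\<Union>k\<in>F \<inter> freq_box n. ?D k)"
        by (rule sum_infsum) (use F inj in \<open>auto simp: coset_def intro: sumcA\<close>)
      then show ?thesis by (simp flip: sum_distrib_left)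
    qed
    also have "\<dots> \<le> B * 1"
      using \<open>B > 0\<close> infsum_mono2[OF sumcA sumc, of "\<Union>k\<in>F \<inter> freq_box n. ?D k"] le1 by (intro mult_left_mono) auto
    finally have 1: "sum ?t (F \<inter> freq_box n) \<le> B" by simp
    have "sum ?t (F - freq_box n) \<le> (\<Sum>k\<in>F - freq_box n. B * ?s k)"
      by (intro sum_mono outside) auto
    also have "\<dots> = B * sum ?s (F - freq_box n)" by (simp add: sum_distrib_left)
    also have "\<dots> \<le> B * 1"
      using \<open>B > 0\<close> finite_sum_le_infsum[OF sumc, of "F - freq_box n"] le1 F by (intro mult_left_mono) auto
    finally have 2: "sum ?t (F - freq_box n) \<le> B" by simp
    have "sum ?t F = sum ?t (F \<inter> freq_box n) + sum ?t (F - freq_box n)"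
      using F by (rule sum.Int_Diff)
    with 1 2 show ?thesis by linarith
  qed
  have sumt: "?t summable_on UNIV"
    by (rule nonneg_bdd_above_summable_on) (auto intro!: bdd_aboveI[of _ "2 * B"] finite_sums)
  have "infsum ?t UNIV \<le> 2 * B"
    by (rule infsum_le_finite_sums[OF sumt finite_sums])
  then show ?thesis
    using sumt error_op_L2_torus[OF finite_freq_box fL2]
    by (simp add: H_norm_eq weighted_norm_def B_def mult.assoc ennreal_leI)
qed

section \<open>Lower bound by a single character\<close>

lemma weighted_norm_cmult_character:
  assumes "w k \<ge> 0"
  shows "weighted_norm w (\<lambda>x. a * character k x) = ennreal (cmod a * sqrt (w k))"
proof -
  have L2: "(\<lambda>x. a * character k x) \<in> L2_torus"
    using trig_sum_L2_torus[of "{k}" "\<lambda>_. a"] by simp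
  have "((\<lambda>l. (cmod (fourier_coeff (\<lambda>x. a * character k x) l))\<^sup>2 * w l) has_sum (cmod a)\<^sup>2 * w k) UNIV"
    by (rule has_sum_finite_neutralI[of "{k}"]) (auto simp: fourier_coeff_cmult fourier_coeff_character)
  then show ?thesis
    using L2 assms by (simp add: weighted_norm_def has_sum_iff real_sqrt_mult)
qed

lemma weighted_norm_ge_coeff:
  assumes "\<And>k. w k \<ge> 0"
  shows "ennreal (cmod (fourier_coeff f k) * sqrt (w k)) \<le> weighted_norm w f"
proof (cases "f \<in> L2_torus \<and> (\<lambda>k. (cmod (fourier_coeff f k))\<^sup>2 * w k) summable_on UNIV")
  case True
  then have "(cmod (fourier_coeff f k))\<^sup>2 * w k \<le> (\<Sum>\<^sub>\<infinity>k. (cmod (fourier_coeff f k))\<^sup>2 * w k)"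
    using finite_sum_le_infsum[of "\<lambda>k. (cmod (fourier_coeff f k))\<^sup>2 * w k" UNIV "{k}"] assms by simp
  then have "sqrt ((cmod (fourier_coeff f k))\<^sup>2 * w k) \<le> sqrt (\<Sum>\<^sub>\<infinity>k. (cmod (fourier_coeff f k))\<^sup>2 * w k)"
    by simp
  with True show ?thesis
    by (auto simp: weighted_norm_def real_sqrt_mult intro!: ennreal_leI)
qed (auto simp: weighted_norm_def)

text \<open>Sampling alters only coefficients in the box, so a character outside it keeps its own
  coefficient in the error. At \<open>(2 ^ n, 0)\<close> one coordinate vanishes and both weights
  equal \<open>1 + 4 ^ n\<close>.\<close>

lemma operator_norm_error_op_ge:
  "ennreal ((1 + 4 ^ n) powr (- (\<alpha> - \<gamma>) / 2))
    \<le> operator_norm (Hmix_norm \<alpha>) (H_norm \<gamma>) (error_op (freq_box n) z M)"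
proof -
  define k :: "int \<times> int" where "k = (2 ^ n, 0)"
  define W :: real where "W = 1 + 4 ^ n"
  have "W > 0" by (simp add: W_def add_pos_pos)
  have k: "k \<notin> freq_box n" by (simp add: k_def freq_box_def)
  have sq: "(2 ^ n)\<^sup>2 = (4::real) ^ n" by (simp add: power2_eq_square flip: power_mult_distrib)
  have W: "mix_weight k = W" "iso_weight k = W"
    by (simp_all add: mix_weight_def iso_weight_def k_def W_def sq)
  \<comment> \<open>This factor gives the test function mixed norm 1.\<close>
  define a where "a = W powr (- \<alpha> / 2)"
  define f where "f = (\<lambda>x. of_real a * character k x)"
  have root: "sqrt (W powr t) = W powr (t / 2)" for t
    using \<open>W > 0\<close> by (simp add: powr_powr flip: powr_half_sqrt)
  have "Hmix_norm \<alpha> f = ennreal (a * W powr (\<alpha> / 2))"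
    unfolding Hmix_norm_eq f_def by (subst weighted_norm_cmult_character) (simp_all add: W root a_def)
  also have "a * W powr (\<alpha> / 2) = 1"
    using \<open>W > 0\<close> by (simp add: a_def flip: powr_add)
  finally have f1: "Hmix_norm \<alpha> f \<le> 1" by simp
  have "f \<in> L2_torus"
    using trig_sum_L2_torus[of "{k}" "\<lambda>_. of_real a"] by (simp add: f_def)
  then have "fourier_coeff (error_op (freq_box n) z M f) k = of_real a"
    using k by (simp add: fourier_coeff_error_op[OF finite_freq_box] f_def fourier_coeff_cmult fourier_coeff_character)
  then have "ennreal (a * W powr (\<gamma> / 2)) \<le> H_norm \<gamma> (error_op (freq_box n) z M f)"
    using weighted_norm_ge_coeff[of "\<lambda>k. iso_weight k powr \<gamma>" "error_op (freq_box n) z M f" k]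
    by (simp add: H_norm_eq W root a_def)
  also have "a * W powr (\<gamma> / 2) = W powr (- (\<alpha> - \<gamma>) / 2)"
    by (simp add: a_def diff_divide_distrib flip: powr_add)
  also have "H_norm \<gamma> (error_op (freq_box n) z M f)
      \<le> operator_norm (Hmix_norm \<alpha>) (H_norm \<gamma>) (error_op (freq_box n) z M)"
    unfolding operator_norm_def using f1 by (intro SUP_upper) simp
  finally show ?thesis by (simp add: W_def)
qed

text \<open>For \<open>n\<close> the floor of \<open>R\<close>, the numbers \<open>4 ^ n\<close> and
  \<open>2 powr (2 * R)\<close> agree up to a factor 4, so the bounds on \<open>M\<close> turn rates
  in \<open>4 ^ n\<close> into rates in \<open>M\<close>.\<close>

theorem theorem5p3:
  fixes \<alpha> \<gamma> c1 c2 :: real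
  assumes "\<alpha> > 1 / 2" and "\<gamma> \<ge> 0" and "\<alpha> > \<gamma>" and "0 < c1" and "c1 \<le> c2"
  shows "\<exists>c C :: real. c > 0 \<and> C > 0 \<and>
    (\<forall>(R::real) (z::int \<times> int) (M::nat).
       R \<ge> 0 \<and> reconstructing (G R) z M \<and>
       c1 * 2 powr (2 * R) \<le> real M \<and> real M \<le> c2 * 2 powr (2 * R) \<longrightarrow>
       ennreal (c * real M powr (- (\<alpha> - \<gamma>) / 2))
         \<le> operator_norm (Hmix_norm \<alpha>) (H_norm \<gamma>) (error_op (G R) z M) \<and>
       operator_norm (Hmix_norm \<alpha>) (H_norm \<gamma>) (error_op (G R) z M)
         \<le> ennreal (C * real M powr (- (\<alpha> - \<gamma>) / 2)))"
proof -
  define d where "d = \<alpha> - \<gamma>"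
  \<comment> \<open>The base comes from \<open>1 + 4 ^ n \<le> 2 / c1 * real M\<close>, which the
    negative exponent reverses.\<close>
  define c where "c = (2 / c1) powr (- d / 2)"
  \<comment> \<open>The base comes from \<open>1 / (4 * c2) * real M \<le> 4 ^ n\<close>, where the
    4 is the loss from rounding \<open>R\<close> down.\<close>
  define C where "C = sqrt (2 * error_const \<alpha> \<gamma>) * (1 / (4 * c2)) powr (- d / 2)"
  have "d > 0" "c2 > 0" using assms by (auto simp: d_def)
  have "c > 0" using assms by (simp add: c_def)
  have "C > 0" using \<open>c2 > 0\<close> error_const_pos by (simp add: C_def)
  have "ennreal (c * real M powr (- d / 2)) \<le> operator_norm (Hmix_norm \<alpha>) (H_norm \<gamma>) (error_op (G R) z M)
     \<and> operator_norm (Hmix_norm \<alpha>) (H_norm \<gamma>) (error_op (G R) z M) \<le> ennreal (C * real M powr (- d / 2))"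
    if R: "R \<ge> 0" and rec: "reconstructing (G R) z M"
      and M1: "c1 * 2 powr (2 * R) \<le> real M" and M2: "real M \<le> c2 * 2 powr (2 * R)" for R z M
  proof -
    define n where "n = nat \<lfloor>R\<rfloor>"
    have G: "G R = freq_box n" unfolding n_def by (rule G_eq_freq_box[OF R])
    have n: "real n \<le> R" "R \<le> real n + 1" using R by (simp_all add: n_def)
    have four: "(4::real) ^ n = 2 powr (2 * real n)"
      by (simp add: powr_powr[symmetric] powr_realpow)
    have "0 < c1 * 2 powr (2 * R)" using assms by simp
    with M1 have Mpos: "real M > 0" by linarith
    have low: "1 + 4 ^ n \<le> 2 / c1 * real M"
    proof -
      have "(4::real) ^ n \<le> 2 powr (2 * R)" unfolding four using n by (intro powr_mono) auto
      also have "\<dots> \<le> real M / c1" using M1 assms by (simp add: field_simps)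
      finally have le: "4 ^ n \<le> real M / c1" .
      have "1 + 4 ^ n \<le> (4::real) ^ n + 4 ^ n" by simp
      also have "\<dots> \<le> real M / c1 + real M / c1" by (intro add_mono le)
      finally show ?thesis by simp
    qed
    have up: "1 / (4 * c2) * real M \<le> 4 ^ n"
    proof -
      have "2 powr (2 * R) \<le> 2 powr (2 * real n + 2)" using n by (intro powr_mono) auto
      also have "\<dots> = 4 * 4 ^ n" by (simp add: four powr_add)
      finally have "c2 * 2 powr (2 * R) \<le> c2 * (4 * 4 ^ n)" using \<open>c2 > 0\<close> by simp
      with M2 have "real M \<le> c2 * (4 * 4 ^ n)" by linarith
      then show ?thesis using \<open>c2 > 0\<close> by (simp add: field_simps)
    qed
    have "c * real M powr (- d / 2) = (2 / c1 * real M) powr (- d / 2)"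
      unfolding c_def using assms by (subst powr_mult) auto
    also have "\<dots> \<le> (1 + 4 ^ n) powr (- d / 2)"
      using low \<open>d > 0\<close> by (intro powr_mono2') (auto simp: add_pos_pos)
    finally have lower: "ennreal (c * real M powr (- d / 2)) \<le> ennreal ((1 + 4 ^ n) powr (- d / 2))"
      by (rule ennreal_leI)
    have "sqrt (2 * error_const \<alpha> \<gamma> * (4 ^ n) powr (- d)) = sqrt (2 * error_const \<alpha> \<gamma>) * (4 ^ n) powr (- d / 2)"
      by (simp add: real_sqrt_mult powr_powr flip: powr_half_sqrt)
    also have "\<dots> \<le> sqrt (2 * error_const \<alpha> \<gamma>) * (1 / (4 * c2) * real M) powr (- d / 2)"
      using up Mpos \<open>c2 > 0\<close> \<open>d > 0\<close> error_const_pos[of \<alpha> \<gamma>]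
      by (intro mult_left_mono powr_mono2') auto
    also have "\<dots> = C * real M powr (- d / 2)"
      unfolding C_def using \<open>c2 > 0\<close> by (subst powr_mult) auto
    finally have upper: "ennreal (sqrt (2 * error_const \<alpha> \<gamma> * (4 ^ n) powr (- d)))
        \<le> ennreal (C * real M powr (- d / 2))"
      by (rule ennreal_leI)
    have "operator_norm (Hmix_norm \<alpha>) (H_norm \<gamma>) (error_op (freq_box n) z M)
        \<le> ennreal (sqrt (2 * error_const \<alpha> \<gamma> * (4 ^ n) powr (- d)))"
      unfolding operator_norm_def d_def
      using assms rec Mpos by (intro SUP_least H_norm_error_op_le) (auto simp: G)
    with upper lower operator_norm_error_op_ge[of n \<alpha> \<gamma> z M] show ?thesis
      unfolding G d_def by (meson order_trans)
  qed
  with \<open>c > 0\<close> \<open>C > 0\<close> show ?thesis unfolding d_def by blast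
qed

end
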